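(* Let $\Lambda=\{\lambda_0,\lambda_1,\lambda_2\}\subseteq\mathbb{Z}$ be a set of three distinct integers. Consider the following extremal problem: to find $g(t)=c_0e^{i\lambda_0t}+c_1e^{i\lambda_1t}+c_2e^{i\lambda_2t}$ (with $c_0,c_1,c_2\in\mathbb{C}$) with $\|g\|_\infty=\max_t|g(t)|\le1$ such that $\|\widehat g\|_1=|c_0|+|c_1|+|c_2|$ is maximal. The solution to this extremal problem is a multiple of $$f(t)=\epsilon_0\,|\lambda_1-\lambda_2|\,e^{i\lambda_0t}+\epsilon_1\,|\lambda_0-\lambda_2|\,e^{i\lambda_1t}+\epsilon_2\,|\lambda_0-\lambda_1|\,e^{i\lambda_2t}$$ with $\epsilon_0,\epsilon_1,\epsilon_2\in\{-1,1\}$ real signs such that - $\epsilon_0\epsilon_1=-1$ if $2^j\mid\lambda_1-\lambda_0$ and $2^j\nmid\lambda_2-\lambda_0$ for some $j$; - $\epsilon_0\epsilon_2=-1$ if $2^j\nmid\lambda_1-\lambda_0$ and $2^j\mid\lambda_2-\lambda_0$ for some $j$; - $\epsilon_1\epsilon_2=-1$ otherwise. The Sidon constant $C$ of $\Lambda$ is attained for this $f$, i.e. $\|\widehat f\|_1=C\|f\|_\infty$. Therefore the complex and real unconditionality constants of $\{e_\lambda\}_{\lambda\in\Lambda}$ in $\mathscr{C}(\mathbb{T})$ coincide for sets $\Lambda$ with three elements.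
   Context: Let $\mathbb{T}=\{z\in\mathbb{C}:|z|=1\}$ and $e_\lambda(z)=z^\lambda$ for $z\in\mathbb{T}$, $\lambda\in\mathbb{Z}$. $\mathscr{C}(\mathbb{T})$ is the space of continuous complex functions on $\mathbb{T}$ with the supremum norm. A trigonometric polynomial $\sum c_\lambda e^{i\lambda t}$ is identified with $\sum c_\lambda e_\lambda$ via $z=e^{it}$. In the sign conditions, $j$ denotes a nonnegative integer. The Sidon constant of a set $\Lambda\subseteq\mathbb{Z}$ is the smallest constant $C$ such that $\|\widehat f\|_1=\sum_{\lambda\in\Lambda}|c_\lambda|\le C\max_t|f(t)|=C\|f\|_\infty$ for all trigonometric polynomials $f(t)=\sum_{\lambda\in\Lambda}c_\lambda e^{i\lambda t}$ with spectrum in $\Lambda$. For a sequence $(x_n)$ in a Banach space $X$, the real (respectively complex) unconditionality constant of $(x_n)$ in $X$ is the smallest constant $C$ such that $\bigl\|\sum\vartheta_nc_nx_n\bigr\|_X\le C\bigl\|\sum c_nx_n\bigr\|_X$ for every choice of signs $\vartheta_n\in\{-1,1\}$ (respectively $\vartheta_n\in\mathbb{T}$) and every finitely supported family of (complex) coefficients $(c_n)$. *)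

theory Defs
  imports "HOL-Analysis.Analysis"
begin

section \<open>Trigonometric polynomials and Sidon constants\<close>

text \<open>A trigonometric polynomial is given by its family of coefficients; the \<open>l\<^sup>1\<close> norm of its
  Fourier transform is the sum of the moduli of the coefficients.\<close>

definition trig_poly :: "int set \<Rightarrow> (int \<Rightarrow> complex) \<Rightarrow> real \<Rightarrow> complex" where
  "trig_poly A c t = (\<Sum>l\<in>A. c l * cis (of_int l * t))"

definition trinomial :: "int \<Rightarrow> int \<Rightarrow> int \<Rightarrow> complex \<Rightarrow> complex \<Rightarrow> complex \<Rightarrow> real \<Rightarrow> complex" where
  "trinomial l0 l1 l2 c0 c1 c2 t =
     c0 * cis (of_int l0 * t) + c1 * cis (of_int l1 * t) + c2 * cis (of_int l2 * t)"

definition sup_norm :: "(real \<Rightarrow> complex) \<Rightarrow> real" where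
  "sup_norm f = (SUP t. cmod (f t))"

definition is_smallest :: "(real \<Rightarrow> bool) \<Rightarrow> real \<Rightarrow> bool" where
  "is_smallest P C \<longleftrightarrow> P C \<and> (\<forall>C'. P C' \<longrightarrow> C \<le> C')"

definition is_sidon_constant :: "int set \<Rightarrow> real \<Rightarrow> bool" where
  "is_sidon_constant \<Lambda> = is_smallest (\<lambda>C. \<forall>A c. finite A \<and> A \<subseteq> \<Lambda> \<longrightarrow>
     (\<Sum>l\<in>A. cmod (c l)) \<le> C * sup_norm (trig_poly A c))"

text \<open>The trinomial \<open>g\<close> with coefficients \<open>c0, c1, c2\<close> maximises the sum of the moduli of its
  coefficients under the constraint \<open>\<parallel>g\<parallel>\<^sub>\<infinity> \<le> 1\<close>.\<close>

definition is_extremal :: "int \<Rightarrow> int \<Rightarrow> int \<Rightarrow> complex \<Rightarrow> complex \<Rightarrow> complex \<Rightarrow> bool" where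
  "is_extremal l0 l1 l2 c0 c1 c2 \<longleftrightarrow>
     sup_norm (trinomial l0 l1 l2 c0 c1 c2) \<le> 1 \<and>
     (\<forall>d0 d1 d2. sup_norm (trinomial l0 l1 l2 d0 d1 d2) \<le> 1 \<longrightarrow>
        cmod d0 + cmod d1 + cmod d2 \<le> cmod c0 + cmod c1 + cmod c2)"


section \<open>Complex Banach spaces and unconditionality constants\<close>

class complex_banach = banach +
  fixes scaleC :: "complex \<Rightarrow> 'a \<Rightarrow> 'a"  (infixr \<open>*\<^sub>C\<close> 75)
  assumes scaleC_add_right: "a *\<^sub>C (x + y) = a *\<^sub>C x + a *\<^sub>C y"
    and scaleC_add_left: "(a + b) *\<^sub>C x = a *\<^sub>C x + b *\<^sub>C x"
    and scaleC_scaleC: "a *\<^sub>C b *\<^sub>C x = (a * b) *\<^sub>C x"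
    and scaleC_of_real: "of_real r *\<^sub>C x = r *\<^sub>R x"
    and norm_scaleC: "norm (a *\<^sub>C x) = cmod a * norm x"

text \<open>Families indexed by a set \<open>I\<close>; \<open>\<Theta>\<close> is the set of allowed signs. The sums run over the
  (finite) support of the coefficients.\<close>

definition is_uncond_constant ::
    "complex set \<Rightarrow> 'i set \<Rightarrow> ('i \<Rightarrow> 'a::complex_banach) \<Rightarrow> real \<Rightarrow> bool" where
  "is_uncond_constant \<Theta> I x = is_smallest (\<lambda>C. \<forall>\<theta> c.
     (\<forall>n\<in>I. \<theta> n \<in> \<Theta>) \<and> finite {n\<in>I. c n \<noteq> 0} \<longrightarrow>
     norm (\<Sum>n\<in>{n\<in>I. c n \<noteq> 0}. (\<theta> n * c n) *\<^sub>C x n)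
       \<le> C * norm (\<Sum>n\<in>{n\<in>I. c n \<noteq> 0}. c n *\<^sub>C x n))"

abbreviation is_real_uncond_constant ::
    "'i set \<Rightarrow> ('i \<Rightarrow> 'a::complex_banach) \<Rightarrow> real \<Rightarrow> bool" where
  "is_real_uncond_constant \<equiv> is_uncond_constant {-1, 1}"

abbreviation is_complex_uncond_constant ::
    "'i set \<Rightarrow> ('i \<Rightarrow> 'a::complex_banach) \<Rightarrow> real \<Rightarrow> bool" where
  "is_complex_uncond_constant \<equiv> is_uncond_constant {z. cmod z = 1}"


section \<open>Continuous functions on the circle\<close>

typedef circle = "{z :: complex. cmod z = 1}"
  morphisms circle_val Circle
  by (rule exI[of _ 1]) simp

instantiation circle :: metric_space
begin

definition dist_circle :: "circle \<Rightarrow> circle \<Rightarrow> real" where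
  "dist_circle z w = dist (circle_val z) (circle_val w)"

definition uniformity_circle :: "(circle \<times> circle) filter" where
  "uniformity_circle = (INF e\<in>{0<..}. principal {(z, w). dist z w < e})"

definition open_circle :: "circle set \<Rightarrow> bool" where
  "open_circle U = (\<forall>z\<in>U. \<forall>\<^sub>F (z', w) in uniformity. z' = z \<longrightarrow> w \<in> U)"

instance
proof
  fix x y z :: circle
  show "dist x y = 0 \<longleftrightarrow> x = y"
    by (simp add: dist_circle_def circle_val_inject)
  show "dist x y \<le> dist x z + dist y z"
    unfolding dist_circle_def by (rule dist_triangle2)
qed (rule open_circle_def uniformity_circle_def)+

end

lemma cmod_circle_val [simp]: "cmod (circle_val z) = 1"
  using circle_val[of z] by simp

lemma continuous_on_circle_val [continuous_intros]: "continuous_on S circle_val"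
  by (auto simp: continuous_on_iff dist_circle_def)

lemma compact_UNIV_circle: "compact (UNIV :: circle set)"
proof -
  have "continuous_on (sphere 0 1) Circle"
    by (auto simp: continuous_on_iff dist_circle_def Circle_inverse)
  then have "compact (Circle ` sphere 0 1)"
    by (rule compact_continuous_image) simp
  moreover have "z \<in> Circle ` sphere 0 1" for z
    by (rule image_eqI[of _ _ "circle_val z"]) (simp_all add: circle_val_inverse)
  ultimately show ?thesis
    by (metis UNIV_eq_I)
qed

text \<open>The circle being compact, the type of bounded continuous functions on it is the space
  of all continuous functions with the supremum norm.\<close>

lemma bcontfun_circle: "(f :: circle \<Rightarrow> 'b::metric_space) \<in> bcontfun \<longleftrightarrow> continuous_on UNIV f"
  unfolding bcontfun_def
  using compact_UNIV_circle compact_continuous_image compact_imp_bounded by blast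

instance bcontfun :: (metric_space, banach) banach ..

instantiation complex :: complex_banach
begin

definition scaleC_complex :: "complex \<Rightarrow> complex \<Rightarrow> complex" where
  "scaleC_complex = (*)"

instance
  by standard (simp_all add: scaleC_complex_def algebra_simps norm_mult scaleR_conv_of_real)

end

lemma continuous_on_scaleC [continuous_intros]:
  fixes f :: "'b::topological_space \<Rightarrow> 'a::complex_banach"
  assumes "continuous_on S f"
  shows "continuous_on S (\<lambda>x. a *\<^sub>C f x)"
proof -
  have "bounded_linear (\<lambda>x::'a. a *\<^sub>C x)"
  proof (rule bounded_linear_intro)
    show "a *\<^sub>C (r *\<^sub>R x) = r *\<^sub>R a *\<^sub>C x" for r and x :: 'a
      by (metis mult.commute scaleC_of_real scaleC_scaleC)
    show "norm (a *\<^sub>C x) \<le> norm x * cmod a" for x :: 'a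
      by (simp add: norm_scaleC mult.commute)
  qed (rule scaleC_add_right)
  then show ?thesis
    using assms by (rule bounded_linear.continuous_on)
qed

instantiation bcontfun :: (metric_space, complex_banach) complex_banach
begin

definition scaleC_bcontfun :: "complex \<Rightarrow> ('a \<Rightarrow>\<^sub>C 'b) \<Rightarrow> 'a \<Rightarrow>\<^sub>C 'b" where
  "scaleC_bcontfun a f = Bcontfun (\<lambda>z. a *\<^sub>C apply_bcontfun f z)"

lemma apply_bcontfun_scaleC [simp]:
  fixes f :: "'a \<Rightarrow>\<^sub>C 'b"
  shows "apply_bcontfun (a *\<^sub>C f) z = a *\<^sub>C apply_bcontfun f z"
proof -
  have "(\<lambda>z. a *\<^sub>C apply_bcontfun f z) \<in> bcontfun"
  proof (rule bcontfun_normI)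
    show "norm (a *\<^sub>C apply_bcontfun f z) \<le> cmod a * norm f" for z
      by (simp add: norm_scaleC mult_left_mono norm_bounded)
  qed (intro continuous_intros continuous_on_apply_bcontfun)
  then show ?thesis
    by (simp add: scaleC_bcontfun_def Bcontfun_inverse)
qed

instance
proof
  fix a b :: complex and r :: real and f g :: "'a \<Rightarrow>\<^sub>C 'b"
  show "a *\<^sub>C (f + g) = a *\<^sub>C f + a *\<^sub>C g"
    by (rule bcontfun_eqI) (simp add: scaleC_add_right)
  show "(a + b) *\<^sub>C f = a *\<^sub>C f + b *\<^sub>C f"
    by (rule bcontfun_eqI) (simp add: scaleC_add_left)
  show ass: "a *\<^sub>C b *\<^sub>C f = (a * b) *\<^sub>C f" for a b and f :: "'a \<Rightarrow>\<^sub>C 'b"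
    by (rule bcontfun_eqI) (simp add: scaleC_scaleC)
  show re: "complex_of_real r *\<^sub>C f = r *\<^sub>R f" for r and f :: "'a \<Rightarrow>\<^sub>C 'b"
    by (rule bcontfun_eqI) (simp add: scaleC_of_real)
  have le: "norm (a *\<^sub>C f) \<le> cmod a * norm f" for a and f :: "'a \<Rightarrow>\<^sub>C 'b"
    by (rule norm_bound) (simp add: norm_scaleC mult_left_mono norm_bounded)
  show "norm (a *\<^sub>C f) = cmod a * norm f"
  proof (cases "a = 0")
    case True
    then show ?thesis using re[of 0 f] by simp
  next
    case False
    have "f = inverse a *\<^sub>C a *\<^sub>C f"
      using False re[of 1 f] by (simp add: ass)
    then have "norm f \<le> cmod (inverse a) * norm (a *\<^sub>C f)"
      using le[of "inverse a" "a *\<^sub>C f"] by simp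
    then have "cmod a * norm f \<le> norm (a *\<^sub>C f)"
      using False by (simp add: norm_inverse norm_divide field_simps)
    then show ?thesis using le[of a f] by simp
  qed
qed

end

definition circle_char :: "int \<Rightarrow> circle \<Rightarrow>\<^sub>C complex" where
  "circle_char l = Bcontfun (\<lambda>z. circle_val z powi l)"

lemma circle_char_apply [simp]: "apply_bcontfun (circle_char l) z = circle_val z powi l"
proof -
  have "circle_val z \<noteq> 0" for z
    by (metis cmod_circle_val norm_zero zero_neq_one)
  then have "(\<lambda>z. circle_val z powi l) \<in> bcontfun"
    unfolding bcontfun_circle by (intro continuous_intros) auto
  then show ?thesis
    by (simp add: circle_char_def Bcontfun_inverse)
qed

end

(*
Up to a translation and a unimodular factor, the phases of a trinomial matter only through one
angle. Let m be the middle frequency, m - d p and m + d q the others, with d the gcd of the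
differences, p, q coprime and n = p + q, and let c0, c1, c2 be the coefficients in this order. By
Bezout some t aligns the two outer terms with each other, at an angle delta from the
middle one with |delta| <= pi/n; there |g(t)| = | |c0| + (|c1| + |c2|) e^(i delta) |, which is at
least (|c0| + |c1| + |c2|) cos(pi/(2n)). Equality in the sup norm forces delta = pi/n and
|c0| = |c1| + |c2|, and then stationarity of |g| at t forces |c1| p = |c2| q, so the extremal
trinomial is unique up to scaling and translation. That it is extremal follows by bounding cos on
[0, pi] by its tangent at pi/(2n).

Multiplying the coefficients of f by its own signs makes them positive, so real signs already
realise the Sidon constant as an unconditionality constant.
*)
theory Submission
  imports Defs
begin

section \<open>A weighted cosine inequality\<close>

lemma sin_ge_on_middle:
  fixes a x :: real
  assumes "0 \<le> a" "a \<le> x" "x \<le> pi - a"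
  shows "sin a \<le> sin x"
proof (cases "x \<le> pi / 2")
  case True
  then show ?thesis using assms by (intro sin_monotone_2pi_le) auto
next
  case False
  then have "sin a \<le> sin (pi - x)" using assms by (intro sin_monotone_2pi_le) auto
  then show ?thesis by simp
qed

text \<open>This says that the tangent to cos at \<open>a\<close> still lies above cos at pi. The
  difference of the two sides has derivative \<open>- cos x * (pi - x)\<close>, so it decreases up
  to pi/4 and only the value there has to be checked.\<close>

lemma sin_mult_pi_diff_le:
  fixes a :: real
  assumes "0 \<le> a" "a \<le> pi / 4"
  shows "sin a * (pi - a) \<le> 1 + cos a"
proof -
  have "1 + cos (pi/4) - sin (pi/4) * (pi - pi/4) \<le> 1 + cos a - sin a * (pi - a)"
  proof (rule DERIV_nonpos_imp_nonincreasing[OF assms(2)])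
    fix x assume x: "a \<le> x" "x \<le> pi / 4"
    have "((\<lambda>x. 1 + cos x - sin x * (pi - x)) has_real_derivative - cos x * (pi - x)) (at x)"
      by (auto intro!: derivative_eq_intros)
    moreover have "0 \<le> cos x" using assms x by (intro cos_ge_zero) auto
    moreover have "0 \<le> pi - x" using assms x pi_gt_zero by linarith
    ultimately show "\<exists>y. ((\<lambda>x. 1 + cos x - sin x * (pi - x)) has_real_derivative y) (at x) \<and> y \<le> 0"
      by (intro exI conjI) auto
  qed
  moreover have "0 \<le> 1 + cos (pi/4) - sin (pi/4) * (pi - pi/4)"
  proof -
    \<comment> \<open>At pi/4 the claim reads \<open>sqrt 2 * (3/4 * pi - 1) \<le> 2\<close>; the
      rational bounds 10/7 and 7/5 on the two factors have product exactly 2.\<close>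
    have "sqrt 2 \<le> sqrt ((10/7)\<^sup>2)" by (rule real_sqrt_le_mono) (simp add: power2_eq_square)
    then have "sqrt 2 * (3 / 4 * pi - 1) \<le> 10/7 * (7/5)"
      using pi_approx by (intro mult_mono) auto
    then show ?thesis by (simp add: cos_45 sin_45 field_simps)
  qed
  ultimately show ?thesis by linarith
qed

text \<open>Cosine is not concave on [0, pi], so convexity alone does not give the bound. The gap
  \<open>D\<close> decreases up to \<open>a\<close>, increases up to \<open>pi - a\<close> and
  decreases again; it is 0 at \<open>a\<close>, and at pi it is controlled by
  \<open>sin_mult_pi_diff_le\<close>.\<close>

lemma cos_le_tangent:
  fixes a x :: real
  assumes a: "0 \<le> a" "a \<le> pi / 4" and x: "0 \<le> x" "x \<le> pi"
  shows "cos x \<le> cos a - sin a * (x - a)"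
proof -
  define D where "D = (\<lambda>x. cos a - sin a * (x - a) - cos x)"
  have D': "(D has_real_derivative sin x - sin a) (at x)" for x
    unfolding D_def by (auto intro!: derivative_eq_intros)
  consider "x \<le> a" | "a \<le> x" "x \<le> pi - a" | "pi - a \<le> x" by linarith
  then have "0 \<le> D x"
  proof cases
    case 1
    have "D a \<le> D x"
    proof (rule DERIV_nonpos_imp_nonincreasing[OF 1])
      fix y assume "x \<le> y" "y \<le> a"
      then have "sin y \<le> sin a" using x a by (intro sin_monotone_2pi_le) auto
      then show "\<exists>z. (D has_real_derivative z) (at y) \<and> z \<le> 0"
        using D'[of y] by (intro exI conjI) auto
    qed
    then show ?thesis by (simp add: D_def)
  next
    case 2
    have "D a \<le> D x"
    proof (rule DERIV_nonneg_imp_nondecreasing[OF 2(1)])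
      fix y assume "a \<le> y" "y \<le> x"
      then have "sin a \<le> sin y" using 2 a by (intro sin_ge_on_middle) auto
      then show "\<exists>z. (D has_real_derivative z) (at y) \<and> z \<ge> 0"
        using D'[of y] by (intro exI conjI) auto
    qed
    then show ?thesis by (simp add: D_def)
  next
    case 3
    have "D pi \<le> D x"
    proof (rule DERIV_nonpos_imp_nonincreasing[OF x(2)])
      fix y assume y: "x \<le> y" "y \<le> pi"
      then have "sin (pi - y) \<le> sin a" using x a 3 by (intro sin_monotone_2pi_le) auto
      then show "\<exists>z. (D has_real_derivative z) (at y) \<and> z \<le> 0"
        using D'[of y] by (intro exI conjI) auto
    qed
    moreover have "0 \<le> D pi" using sin_mult_pi_diff_le[OF a] by (simp add: D_def)
    ultimately show ?thesis by simp
  qed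
  then show ?thesis by (simp add: D_def)
qed

lemma reduce_mod_2pi:
  fixes x :: real
  obtains k :: int where "\<bar>x - 2 * pi * k\<bar> \<le> pi"
proof -
  define k where "k = round (x / (2 * pi))"
  have "\<bar>x / (2*pi) - k\<bar> \<le> 1/2"
    unfolding k_def using of_int_round_abs_le[of "x/(2*pi)"] by (simp add: abs_minus_commute)
  then have "\<bar>x / (2*pi) - k\<bar> * (2 * pi) \<le> 1/2 * (2*pi)" by (intro mult_right_mono) auto
  then have "\<bar>(x / (2*pi) - k) * (2 * pi)\<bar> \<le> pi" by (simp add: abs_mult)
  moreover have "(x / (2*pi) - k) * (2 * pi) = x - 2 * pi * k" by (simp add: field_simps)
  ultimately show ?thesis using that[of k] by simp
qed

text \<open>Bound each cosine by the tangent at \<open>pi / (2 * n)\<close>, evaluated at the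
  distance of the angle from the multiples of 2 pi. The linear terms then have the right sign
  because the constraint forces the weighted sum of these distances to be at least pi.\<close>

lemma weighted_cos_le:
  fixes p q :: int and x y z :: real
  assumes pq: "0 < p" "0 < q" and xyz: "q * y + p * z - (p + q) * x = pi"
  shows "(p + q) * cos x + q * cos y + p * cos z \<le> 2 * (p + q) * cos (pi / (2 * (p + q)))"
proof -
  obtain i j k :: int where ijk: "\<bar>x - 2*pi*i\<bar> \<le> pi" "\<bar>y - 2*pi*j\<bar> \<le> pi" "\<bar>z - 2*pi*k\<bar> \<le> pi"
    using reduce_mod_2pi[of x] reduce_mod_2pi[of y] reduce_mod_2pi[of z] by metis
  define n where "n = real_of_int (p + q)"
  \<comment> \<open>The weights add up to \<open>2 * n\<close>, so this point of contact makes the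
    linear terms cancel when the weighted distances sum to pi. The bound \<open>n \<ge> 2\<close>
    puts it below pi/4.\<close>
  define a where "a = pi / (2 * n)"
  have n2: "n \<ge> 2" using pq by (simp add: n_def)
  have a: "0 \<le> a" "a \<le> pi/4" using n2 by (auto simp: a_def divide_simps)
  have tangent: "cos u \<le> cos a - sin a * (\<bar>u - 2*pi*m\<bar> - a)" if "\<bar>u - 2*pi*m\<bar> \<le> pi" for u :: real and m :: int
  proof -
    have "cos u = cos (u - 2*pi*m)"
      using cos_int_2pin[of m] sin_int_2pin[of m] by (simp add: cos_diff mult.commute mult.left_commute)
    then show ?thesis using cos_le_tangent[OF a _ that] by simp
  qed
  define X Y Z where "X = x - 2*pi*i" and "Y = y - 2*pi*j" and "Z = z - 2*pi*k"
  \<comment> \<open>Reducing the angles mod 2 pi turns pi into an odd multiple of pi, whose modulus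
    is still at least pi.\<close>
  define N where "N = q * j + p * k - (p + q) * i"
  have "q * Y + p * Z - n * X = pi - 2 * pi * N"
    using xyz by (simp add: X_def Y_def Z_def n_def N_def algebra_simps)
  also have "\<dots> = pi * (1 - 2 * N)" by (simp add: algebra_simps)
  finally have "\<bar>q * Y + p * Z - n * X\<bar> = pi * \<bar>1 - 2 * N\<bar>" by (simp add: abs_mult)
  moreover have "1 \<le> \<bar>1 - 2 * N\<bar>" by presburger
  then have "1 \<le> real_of_int \<bar>1 - 2 * N\<bar>" by linarith
  then have "pi * 1 \<le> pi * real_of_int \<bar>1 - 2 * N\<bar>" by (intro mult_left_mono) auto
  moreover have "\<bar>q * Y + p * Z - n * X\<bar> \<le> q * \<bar>Y\<bar> + p * \<bar>Z\<bar> + n * \<bar>X\<bar>"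
  proof -
    have "\<bar>q * Y\<bar> = q * \<bar>Y\<bar>" "\<bar>p * Z\<bar> = p * \<bar>Z\<bar>" "\<bar>n * X\<bar> = n * \<bar>X\<bar>"
      using pq n2 by (simp_all add: abs_mult)
    then show ?thesis by linarith
  qed
  ultimately have ge: "pi \<le> q * \<bar>Y\<bar> + p * \<bar>Z\<bar> + n * \<bar>X\<bar>" by linarith
  have "n * cos x + q * cos y + p * cos z \<le> n * (cos a - sin a * (\<bar>X\<bar> - a))
     + q * (cos a - sin a * (\<bar>Y\<bar> - a)) + p * (cos a - sin a * (\<bar>Z\<bar> - a))"
    using tangent[OF ijk(1)] tangent[OF ijk(2)] tangent[OF ijk(3)] pq n2
    unfolding X_def Y_def Z_def by (intro add_mono mult_left_mono) auto
  also have "\<dots> = 2 * n * cos a - sin a * (q * \<bar>Y\<bar> + p * \<bar>Z\<bar> + n * \<bar>X\<bar> - 2 * n * a)"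
    by (simp add: n_def algebra_simps)
  also have "2 * n * a = pi" using n2 by (simp add: a_def)
  also have "2 * n * cos a - sin a * (q * \<bar>Y\<bar> + p * \<bar>Z\<bar> + n * \<bar>X\<bar> - pi) \<le> 2 * n * cos a"
    using ge a by (simp add: sin_ge_zero)
  finally show ?thesis by (simp add: n_def a_def)
qed

section \<open>Trinomials centred at the middle frequency\<close>

text \<open>A trinomial stripped of its middle frequency, with frequencies counted in units of their
  gcd. The coefficients are ordered by frequency, with the middle one second, whereas
  \<open>trinomial_eq_centred\<close> lists the middle frequency first.\<close>

definition centred :: "int \<Rightarrow> int \<Rightarrow> complex \<Rightarrow> complex \<Rightarrow> complex \<Rightarrow> real \<Rightarrow> complex" where
  "centred p q a b c s = b + a * cis (- (p * s)) + c * cis (q * s)"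

section \<open>Half-angle formula and alignment of the outer phases by translation\<close>

lemma cis_add_2pi_int: "cis (x + 2 * pi * of_int k) = cis x"
  by (simp flip: cis_mult)

text \<open>Division by \<open>cis (d/2)\<close> leaves real part \<open>(x + y) * cos (d/2)\<close>
  and imaginary part \<open>(y - x) * sin (d/2)\<close>. This separates the total weight, which
  gives the lower bound, from the imbalance, which must vanish in the equality case.\<close>

lemma cmod_add_cis_squared:
  "(cmod (of_real x + of_real y * cis d))\<^sup>2 = ((x + y) * cos (d/2))\<^sup>2 + ((x - y) * sin (d/2))\<^sup>2"
proof -
  define S C where "S = sin (d/2)" and "C = cos (d/2)"
  have SC: "S\<^sup>2 + C\<^sup>2 = 1" by (simp add: S_def C_def)
  have "cos d = C\<^sup>2 - S\<^sup>2" using cos_double[of "d/2"] by (simp add: C_def S_def)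
  moreover have "sin d = 2 * S * C" using sin_double[of "d/2"] by (simp add: C_def S_def)
  ultimately have "(cmod (of_real x + of_real y * cis d))\<^sup>2 = (x + y * (C\<^sup>2 - S\<^sup>2))\<^sup>2 + (y * (2 * S * C))\<^sup>2"
    by (simp add: cmod_power2)
  also have "\<dots> = x\<^sup>2 * (S\<^sup>2 + C\<^sup>2) + 2 * x * y * (C\<^sup>2 - S\<^sup>2) + y\<^sup>2 * (S\<^sup>2 + C\<^sup>2)"
    using SC by algebra
  also have "\<dots> = ((x + y) * C)\<^sup>2 + ((x - y) * S)\<^sup>2"
    by (simp add: power2_eq_square algebra_simps)
  finally show ?thesis by (simp add: S_def C_def)
qed

text \<open>The combination of phases on the left of \<open>phase\<close> does not change under
  translation, and mod 2 pi it is the only invariant. Aligning the first outer term fixes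
  \<open>s\<close> up to an integer \<open>U\<close>; the second is then aligned when
  \<open>p * V - q * U = k\<close> is solvable in integers.\<close>

lemma centred_align:
  fixes p q k :: int and r0 r1 r2 \<alpha> \<beta> \<gamma> \<delta> :: real
  assumes p: "0 < p" and "coprime p q"
    and phase: "q * \<alpha> + p * \<gamma> - (p + q) * \<beta> = (p + q) * \<delta> + 2 * pi * k"
  obtains s where "\<And>h. centred p q (of_real r1 * cis \<alpha>) (of_real r0 * cis \<beta>) (of_real r2 * cis \<gamma>) (s + h)
    = cis \<beta> * centred p q (of_real r1 * cis \<delta>) (of_real r0) (of_real r2 * cis \<delta>) h"
proof -
  obtain u v where "u * p + v * q = gcd p q" using bezout_int by blast
  then have uv: "u * p + v * q = 1" using \<open>coprime p q\<close> by simp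
  \<comment> \<open>The Bezout relation multiplied by \<open>k\<close>.\<close>
  define U V where "U = - k * v" and "V = k * u"
  have "p * V - q * U = k * (u * p + v * q)" by (simp add: U_def V_def algebra_simps)
  then have UV: "p * V = k + q * U" using uv by simp
  then have UV': "real_of_int p * V = k + q * U" by (metis of_int_add of_int_mult)
  define s where "s = (\<alpha> - \<beta> - \<delta> + 2 * pi * U) / p"
  have ps: "p * s = \<alpha> - \<beta> - \<delta> + 2 * pi * U" using p by (simp add: s_def)
  have "\<alpha> - p * s = \<beta> + \<delta> + 2 * pi * of_int (- U)" using ps by simp
  then have 1: "cis (\<alpha> - p * s) = cis (\<beta> + \<delta>)" using cis_add_2pi_int by metis
  have "p * (\<gamma> + q * s) = p * \<gamma> + q * (p * s)" by (simp add: algebra_simps)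
  also have "\<dots> = p * (\<beta> + \<delta>) + 2 * pi * (k + q * U)"
    using phase unfolding ps by (simp add: algebra_simps)
  also have "\<dots> = p * (\<beta> + \<delta> + 2 * pi * V)"
    unfolding UV'[symmetric] by (simp add: algebra_simps)
  finally have "\<gamma> + q * s = \<beta> + \<delta> + 2 * pi * V" using p by simp
  then have 2: "cis (\<gamma> + q * s) = cis (\<beta> + \<delta>)" using cis_add_2pi_int by metis
  have "centred p q (of_real r1 * cis \<alpha>) (of_real r0 * cis \<beta>) (of_real r2 * cis \<gamma>) (s + h)
    = cis \<beta> * centred p q (of_real r1 * cis \<delta>) (of_real r0) (of_real r2 * cis \<delta>) h" for h
  proof -
    have "cis \<alpha> * cis (- (p * (s + h))) = cis (\<alpha> - p * s) * cis (- (p * h))"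
      by (simp add: cis_mult algebra_simps)
    then have a: "cis \<alpha> * cis (- (p * (s + h))) = cis \<beta> * cis \<delta> * cis (- (p * h))"
      unfolding 1 by (simp add: cis_mult)
    have "cis \<gamma> * cis (q * (s + h)) = cis (\<gamma> + q * s) * cis (q * h)"
      by (simp add: cis_mult algebra_simps)
    then have c: "cis \<gamma> * cis (q * (s + h)) = cis \<beta> * cis \<delta> * cis (q * h)"
      unfolding 2 by (simp add: cis_mult)
    have "centred p q (of_real r1 * cis \<alpha>) (of_real r0 * cis \<beta>) (of_real r2 * cis \<gamma>) (s + h)
      = of_real r0 * cis \<beta> + of_real r1 * (cis \<alpha> * cis (- (p * (s + h))))
        + of_real r2 * (cis \<gamma> * cis (q * (s + h)))"
      unfolding centred_def by (simp only: mult.assoc)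
    then show ?thesis
      unfolding a c centred_def by (simp add: distrib_left mult.assoc mult.left_commute)
  qed
  then show ?thesis by (rule that)
qed

text \<open>The half-open interval for \<open>\<delta>\<close> makes the equality case unambiguous: only \<open>\<delta> = pi / n\<close> survives.\<close>

lemma centred_align_small:
  fixes p q :: int
  assumes pq: "0 < p" "0 < q" and co: "coprime p q"
  obtains s \<beta> \<delta> where "- (pi / (p + q)) < \<delta>" "\<delta> \<le> pi / (p + q)"
    "\<And>h. centred p q a b c (s + h)
      = cis \<beta> * centred p q (of_real (cmod a) * cis \<delta>) (of_real (cmod b)) (of_real (cmod c) * cis \<delta>) h"
proof -
  define \<tau> where "\<tau> = q * Arg a + p * Arg c - (p + q) * Arg b"
  define n where "n = real_of_int (p + q)"
  have n: "n > 0" using pq by (simp add: n_def)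
  \<comment> \<open>The ceiling, rather than a floor, puts \<open>\<tau> - 2 * pi * k\<close> in the
    interval from -pi to pi with the right endpoint included.\<close>
  define k where "k = \<lceil>\<tau> / (2 * pi) - 1 / 2\<rceil>"
  define \<delta> where "\<delta> = (\<tau> - 2 * pi * k) / n"
  have "\<tau> / (2 * pi) - 1 / 2 \<le> k" "k < \<tau> / (2 * pi) - 1 / 2 + 1"
    unfolding k_def by linarith+
  then have "\<tau> - pi \<le> 2 * pi * k" "2 * pi * k < \<tau> + pi"
    by (auto simp: field_simps)
  then have d: "- (pi / n) < \<delta>" "\<delta> \<le> pi / n" using n by (auto simp: \<delta>_def divide_simps)
  have "q * Arg a + p * Arg c - (p + q) * Arg b = (p + q) * \<delta> + 2 * pi * k"
  proof -
    have "n * \<delta> + 2 * pi * k = \<tau>" using n by (simp add: \<delta>_def)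
    then show ?thesis by (simp add: \<tau>_def n_def)
  qed
  then obtain s where s: "\<And>h. centred p q (of_real (cmod a) * cis (Arg a)) (of_real (cmod b) * cis (Arg b))
      (of_real (cmod c) * cis (Arg c)) (s + h)
    = cis (Arg b) * centred p q (of_real (cmod a) * cis \<delta>) (of_real (cmod b)) (of_real (cmod c) * cis \<delta>) h"
    using centred_align[OF pq(1) co, of "Arg a" "Arg c" "Arg b" \<delta> k "cmod a" "cmod b" "cmod c"]
    by blast
  have "of_real (cmod z) * cis (Arg z) = z" for z
    using rcis_cmod_Arg[of z] by (simp add: rcis_def)
  then show ?thesis using that[of \<delta> s "Arg b"] s d by (simp add: n_def)
qed

text \<open>The normal form of the extremal trinomial, translated so that its outer terms are
  aligned at 0. Its phase invariant is pi, the value farthest from 0 mod 2 pi.\<close>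

definition extremal_centred :: "int \<Rightarrow> int \<Rightarrow> real \<Rightarrow> complex" where
  "extremal_centred p q = centred p q (of_int q * cis (pi / (p + q))) (of_int (p + q)) (of_int p * cis (pi / (p + q)))"

section \<open>Lower bound for the sup norm and its equality case\<close>

lemma cos_half_pi_div_pos:
  fixes n :: int
  assumes "2 \<le> n"
  shows "0 < cos (pi / (2 * n))"
proof (rule cos_gt_zero)
  show "0 < pi / (2 * n)" using assms by simp
  have "real_of_int n \<ge> 2" using assms by simp
  then show "pi / (2 * n) < pi / 2" by (simp add: field_simps)
qed

lemma centred_aligned_zero:
  "centred p q (of_real x * cis \<delta>) (of_real y) (of_real z * cis \<delta>) 0 = of_real y + of_real (x + z) * cis \<delta>"
  by (simp add: centred_def algebra_simps)

text \<open>A single value suffices: at the aligned point \<open>cmod_add_cis_squared\<close> gives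
  at least the total weight times \<open>cos (\<delta>/2)\<close>, and \<open>\<delta>/2\<close> is
  at most \<open>pi / (2 * (p + q))\<close> in modulus.\<close>

lemma centred_lower_bound:
  fixes p q :: int
  assumes pq: "0 < p" "0 < q" "coprime p q"
    and M: "\<And>s. cmod (centred p q a b c s) \<le> M"
  shows "(cmod a + cmod b + cmod c) * cos (pi / (2 * (p + q))) \<le> M"
proof -
  define n where "n = p + q"
  have n: "n \<ge> 2" using pq by (simp add: n_def)
  obtain s \<beta> \<delta> where d: "- (pi / n) < \<delta>" "\<delta> \<le> pi / n"
    and s: "\<And>h. centred p q a b c (s + h)
      = cis \<beta> * centred p q (of_real (cmod a) * cis \<delta>) (of_real (cmod b)) (of_real (cmod c) * cis \<delta>) h"
    using centred_align_small[OF pq, of a b c] unfolding n_def by blast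
  let ?S = "cmod a + cmod b + cmod c"
  have "\<bar>\<delta>/2\<bar> \<le> pi / (2 * n)" using d by (simp add: abs_le_iff)
  moreover have "pi / (2 * n) \<le> pi" using n by (simp add: field_simps)
  ultimately have "cos (pi / (2 * n)) \<le> cos \<bar>\<delta>/2\<bar>" by (intro cos_monotone_0_pi_le) auto
  then have co: "cos (pi / (2 * n)) \<le> cos (\<delta>/2)" by (metis cos_abs_real)
  have "(?S * cos (pi / (2 * n)))\<^sup>2 \<le> (?S * cos (\<delta>/2))\<^sup>2"
    using co cos_half_pi_div_pos[OF n] by (intro power_mono mult_left_mono) auto
  also have "\<dots> \<le> (cmod (of_real (cmod b) + of_real (cmod a + cmod c) * cis \<delta>))\<^sup>2"
    unfolding cmod_add_cis_squared by (simp add: algebra_simps)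
  also have "cmod (of_real (cmod b) + of_real (cmod a + cmod c) * cis \<delta>) = cmod (centred p q a b c s)"
    using s[of 0] by (simp add: centred_aligned_zero norm_mult)
  finally have "?S * cos (pi / (2 * n)) \<le> cmod (centred p q a b c s)"
    by (rule power2_le_imp_le) simp
  then show ?thesis using M[of s] by (simp add: n_def)
qed

text \<open>The derivative at 0 of the squared modulus simplifies to
  \<open>2 * (x * p - z * q) * (y * sin \<delta>)\<close>, which must vanish at a maximum.\<close>

lemma centred_local_max_balance:
  fixes p q :: int and x y z \<delta> :: real
  assumes "y * sin \<delta> \<noteq> 0"
    and max: "\<And>h. cmod (centred p q (of_real x * cis \<delta>) (of_real y) (of_real z * cis \<delta>) h)
      \<le> cmod (centred p q (of_real x * cis \<delta>) (of_real y) (of_real z * cis \<delta>) 0)"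
  shows "x * p = z * q"
proof -
  define R where "R = (\<lambda>h::real. y + x * cos (\<delta> - p * h) + z * cos (\<delta> + q * h))"
  define I where "I = (\<lambda>h::real. x * sin (\<delta> - p * h) + z * sin (\<delta> + q * h))"
  have eq: "(cmod (centred p q (of_real x * cis \<delta>) (of_real y) (of_real z * cis \<delta>) h))\<^sup>2 = (R h)\<^sup>2 + (I h)\<^sup>2" for h
  proof -
    have "Re (centred p q (of_real x * cis \<delta>) (of_real y) (of_real z * cis \<delta>) h) = R h"
      by (simp add: centred_def R_def cos_diff cos_add algebra_simps)
    moreover have "Im (centred p q (of_real x * cis \<delta>) (of_real y) (of_real z * cis \<delta>) h) = I h"
      by (simp add: centred_def I_def sin_diff sin_add algebra_simps)
    ultimately show ?thesis by (simp add: cmod_power2)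
  qed
  have R': "(R has_real_derivative x * (p * sin \<delta>) - z * (q * sin \<delta>)) (at 0)"
    unfolding R_def by (auto intro!: derivative_eq_intros)
  have I': "(I has_real_derivative z * (q * cos \<delta>) - x * (p * cos \<delta>)) (at 0)"
    unfolding I_def by (auto intro!: derivative_eq_intros)
  have "((\<lambda>h. (R h)\<^sup>2 + (I h)\<^sup>2) has_real_derivative
      2 * R 0 * (x * (p * sin \<delta>) - z * (q * sin \<delta>)) + 2 * I 0 * (z * (q * cos \<delta>) - x * (p * cos \<delta>))) (at 0)"
    by (auto intro!: derivative_eq_intros R' I')
  moreover have "(R h)\<^sup>2 + (I h)\<^sup>2 \<le> (R 0)\<^sup>2 + (I 0)\<^sup>2" for h
    using max[of h] unfolding eq[symmetric] by (intro power_mono) auto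
  ultimately have "2 * R 0 * (x * (p * sin \<delta>) - z * (q * sin \<delta>)) + 2 * I 0 * (z * (q * cos \<delta>) - x * (p * cos \<delta>)) = 0"
    by (intro DERIV_local_max[of "\<lambda>h. (R h)\<^sup>2 + (I h)\<^sup>2" _ 0 1]) auto
  then have "2 * (x * p - z * q) * (y * sin \<delta>) = 0"
    by (simp add: R_def I_def algebra_simps)
  then show ?thesis using assms(1) by simp
qed

text \<open>At the aligned point both squares of \<open>cmod_add_cis_squared\<close> must fit under
  the bound. The cosine square forces \<open>\<delta> = pi / n\<close> and uses up the whole bound,
  so the sine square is 0; this leaves only the ratio of the outer moduli, fixed by
  stationarity.\<close>

lemma centred_equality:
  fixes p q :: int
  assumes pq: "0 < p" "0 < q" "coprime p q"
    and M: "\<And>s. cmod (centred p q a b c s) \<le> (cmod a + cmod b + cmod c) * cos (pi / (2 * (p + q)))"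
  obtains w s where "\<And>h. centred p q a b c (s + h) = w * extremal_centred p q h"
proof -
  define n where "n = p + q"
  have n: "n \<ge> 2" using pq by (simp add: n_def)
  then have n': "real_of_int n \<ge> 2" by simp
  let ?S = "cmod a + cmod b + cmod c"
  obtain s \<beta> \<delta> where d: "- (pi / n) < \<delta>" "\<delta> \<le> pi / n"
    and s: "\<And>h. centred p q a b c (s + h)
      = cis \<beta> * centred p q (of_real (cmod a) * cis \<delta>) (of_real (cmod b)) (of_real (cmod c) * cis \<delta>) h"
    using centred_align_small[OF pq, of a b c] unfolding n_def by blast
  let ?G = "centred p q (of_real (cmod a) * cis \<delta>) (of_real (cmod b)) (of_real (cmod c) * cis \<delta>)"
  have G: "cmod (centred p q a b c (s + h)) = cmod (?G h)" for h
    using s[of h] by (simp add: norm_mult)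
  have M': "cmod (?G h) \<le> ?S * cos (pi / (2 * n))" for h
    using M[of "s + h"] unfolding G n_def .
  show ?thesis
  proof (cases "?S = 0")
    case True
    then have "a = 0" "b = 0" "c = 0"
      by (simp_all add: add_nonneg_eq_0_iff)
    then show ?thesis by (intro that[of 0 0]) (simp add: centred_def)
  next
    case False
    then have S: "?S > 0" by (simp add: less_le del: norm_eq_zero)
    have "(cmod (?G 0))\<^sup>2 \<le> (?S * cos (pi / (2 * n)))\<^sup>2" using M' by (intro power_mono) auto
    then have le: "(?S * cos (\<delta>/2))\<^sup>2 + ((cmod b - (cmod a + cmod c)) * sin (\<delta>/2))\<^sup>2 \<le> (?S * cos (pi / (2 * n)))\<^sup>2"
      unfolding centred_aligned_zero cmod_add_cis_squared by (simp add: algebra_simps)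
    have "(?S * cos (\<delta>/2))\<^sup>2 \<le> (?S * cos (pi / (2 * n)))\<^sup>2" by (rule order_trans[OF _ le]) simp
    moreover have "0 \<le> ?S * cos (pi / (2 * n))"
      using S cos_half_pi_div_pos[OF n] by (intro mult_nonneg_nonneg less_imp_le)
    ultimately have "?S * cos (\<delta>/2) \<le> ?S * cos (pi / (2 * n))" by (rule power2_le_imp_le)
    then have "cos (\<delta>/2) \<le> cos (pi / (2 * n))" using S by (rule mult_left_le_imp_le)
    then have "cos \<bar>\<delta>/2\<bar> \<le> cos (pi / (2 * n))" by (simp only: cos_abs_real)
    moreover have "pi / n \<le> pi / 2" using n' by (intro divide_left_mono) auto
    then have "\<bar>\<delta>/2\<bar> \<le> pi" "pi / (2 * n) \<le> pi" using d pi_gt_zero by (auto simp: abs_le_iff)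
    ultimately have "pi / (2 * n) \<le> \<bar>\<delta>/2\<bar>" using n'
      by (subst (asm) cos_mono_le_eq) auto
    then have \<delta>: "\<delta> = pi / n" using d by (auto simp: abs_if split: if_splits)
    have "0 < sin (\<delta>/2)" "0 < sin \<delta>" using n' unfolding \<delta> by (auto intro!: sin_gt_zero simp: field_simps)
    moreover have "((cmod b - (cmod a + cmod c)) * sin (\<delta>/2))\<^sup>2 \<le> 0" using le unfolding \<delta> by (simp add: mult.commute)
    ultimately have b: "cmod b = cmod a + cmod c" by simp
    then have b0: "cmod b > 0" using S by linarith
    \<comment> \<open>The aligned point attains the assumed upper bound, hence is a global
      maximum.\<close>
    have "cmod (?G h) \<le> cmod (?G 0)" for h
    proof -
      have "(?S * cos (pi / (2 * n)))\<^sup>2 \<le> (cmod (?G 0))\<^sup>2"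
        unfolding centred_aligned_zero cmod_add_cis_squared by (simp add: algebra_simps \<delta>)
      then have "?S * cos (pi / (2 * n)) \<le> cmod (?G 0)" by (rule power2_le_imp_le) simp
      then show ?thesis using M'[of h] by linarith
    qed
    then have bal: "cmod a * p = cmod c * q"
      using b0 \<open>0 < sin \<delta>\<close> by (intro centred_local_max_balance[of "cmod b" \<delta>]) auto
    \<comment> \<open>The common scale: the moduli are \<open>\<rho>\<close> times q, n and
      p.\<close>
    define \<rho> where "\<rho> = cmod a / q"
    have a: "cmod a = \<rho> * q" using pq by (simp add: \<rho>_def)
    have "q * cmod c = q * (\<rho> * p)" using bal unfolding a by (auto simp: mult_ac)
    then have c: "cmod c = \<rho> * p" using pq by auto
    have "cmod b = \<rho> * n" unfolding b a c by (simp add: n_def distrib_left)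
    with a c have "?G h = of_real \<rho> * extremal_centred p q h" for h
      by (simp add: centred_def extremal_centred_def \<delta> n_def algebra_simps)
    then show ?thesis using s that[of s "cis \<beta> * of_real \<rho>"] by (simp add: mult.assoc)
  qed
qed

text \<open>Rotating the value onto the nonnegative real axis by an angle \<open>x\<close> writes
  its modulus as a weighted sum of cosines. In the constraint of \<open>weighted_cos_le\<close> both
  \<open>h\<close> and the part of \<open>x\<close> in the outer angles cancel, leaving the phase
  invariant pi.\<close>

lemma extremal_centred_le:
  fixes p q :: int
  assumes pq: "0 < p" "0 < q"
  shows "cmod (extremal_centred p q h) \<le> 2 * (p + q) * cos (pi / (2 * (p + q)))"
proof -
  define z where "z = extremal_centred p q h"
  define x where "x = - Arg z"
  have "of_real (cmod z) = z * cis x"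
    using rcis_cmod_Arg[of z] unfolding x_def rcis_def
    by (metis cis_mult cis_zero mult.assoc mult.right_neutral right_minus add.right_inverse)
  then have "cmod z = Re (z * cis x)" by (metis Re_complex_of_real)
  also have "\<dots> = (p + q) * cos x + q * cos (pi / (p + q) - p * h + x) + p * cos (pi / (p + q) + q * h + x)"
    unfolding z_def extremal_centred_def centred_def
    by (simp add: cos_add cos_diff sin_add sin_diff algebra_simps)
  also have "\<dots> \<le> 2 * (p + q) * cos (pi / (2 * (p + q)))"
  proof (rule weighted_cos_le[OF pq])
    define n where "n = real_of_int (p + q)"
    define u where "u = pi / n"
    have "n * u = pi" using pq unfolding u_def n_def by simp
    moreover have "q * (u - p * h + x) + p * (u + q * h + x) - n * x = n * u"
      by (simp add: n_def algebra_simps)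
    ultimately show "q * (pi / (p + q) - p * h + x) + p * (pi / (p + q) + q * h + x) - (p + q) * x = pi"
      by (simp add: u_def n_def)
  qed
  finally show ?thesis by (simp add: z_def)
qed

text \<open>Real signs are phases 0 or pi, so their phase invariant is an integer multiple of pi; it
  agrees with that of \<open>extremal_centred\<close> mod 2 pi when the integer is odd. Exactly one
  of p, q and p + q is even, its term drops out mod 2, and the sign condition says that the other
  two signs differ.\<close>

lemma centred_sign_extremal:
  fixes p q :: int and e0 e1 e2 :: real
  assumes pq: "0 < p" "0 < q" "coprime p q"
    and e: "e0 \<in> {-1, 1}" "e1 \<in> {-1, 1}" "e2 \<in> {-1, 1}"
    and sgn: "even q \<Longrightarrow> e0 * e2 = -1" "even (p + q) \<Longrightarrow> e1 * e2 = -1" "even p \<Longrightarrow> e1 * e0 = -1"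
  obtains s u where "cmod u = 1" "\<And>h. centred p q (of_real (e1 * q)) (of_real (e0 * (p + q))) (of_real (e2 * p)) (s + h)
     = u * extremal_centred p q h"
proof -
  define E where "E e = (if e = (1::real) then 0 else 1 :: int)" for e
  have cisE: "cis (E e * pi) = of_real e" if "e \<in> {-1, 1}" for e
    using that by (auto simp: E_def)
  have "odd (q * E e1 + p * E e2 - (p + q) * E e0)"
  proof -
    have "\<not> (even p \<and> even q)" using coprime_common_divisor[OF pq(3), of 2] by auto
    then consider "even p" "odd q" | "odd p" "even q" | "odd p" "odd q" by blast
    then show ?thesis
    proof cases
      case 1
      then show ?thesis using sgn(3) e by (auto simp: E_def)
    next
      case 2
      then show ?thesis using sgn(1) e by (auto simp: E_def)
    next
      case 3
      then show ?thesis using sgn(2) e by (auto simp: E_def)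
    qed
  qed
  then obtain k where k: "q * E e1 + p * E e2 - (p + q) * E e0 = 2 * k + 1" by (rule oddE)
  have "q * (E e1 * pi) + p * (E e2 * pi) - (p + q) * (E e0 * pi)
     = of_int (q * E e1 + p * E e2 - (p + q) * E e0) * pi" by (simp add: algebra_simps)
  also have "\<dots> = pi + 2 * pi * k" unfolding k by (simp add: algebra_simps)
  also have "\<dots> = (p + q) * (pi / (p + q)) + 2 * pi * k"
  proof -
    have "p + q \<noteq> 0" using pq by simp
    then have "real_of_int (p + q) \<noteq> 0" by (simp only: of_int_eq_0_iff not_False_eq_True)
    then show ?thesis by simp
  qed
  finally have phase: "q * (E e1 * pi) + p * (E e2 * pi) - (p + q) * (E e0 * pi) = (p + q) * (pi / (p + q)) + 2 * pi * k" .
  obtain s where s: "\<And>h. centred p q (of_real q * cis (E e1 * pi)) (of_real (p + q) * cis (E e0 * pi))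
      (of_real p * cis (E e2 * pi)) (s + h) = cis (E e0 * pi) * centred p q (of_real q * cis (pi / (p + q)))
      (of_real (p + q)) (of_real p * cis (pi / (p + q))) h"
    using centred_align[OF pq(1,3) phase] by blast
  show ?thesis
    using that[of "cis (E e0 * pi)" s] s unfolding cisE[OF e(1)] cisE[OF e(2)] cisE[OF e(3)] extremal_centred_def
    using e(1) by (auto simp: mult.commute)
qed

section \<open>Sharp Sidon bounds\<close>

lemma sup_norm_le: "(\<And>t. cmod (f t) \<le> M) \<Longrightarrow> sup_norm f \<le> M"
  unfolding sup_norm_def by (rule cSUP_least) auto

lemma cmod_trinomial_le: "cmod (trinomial l0 l1 l2 c0 c1 c2 t) \<le> cmod c0 + cmod c1 + cmod c2"
  unfolding trinomial_def
  by (rule order_trans[OF norm_triangle_ineq] order_trans[OF add_right_mono[OF norm_triangle_ineq]])+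
    (simp add: norm_mult)

lemma le_sup_norm_trinomial: "cmod (trinomial l0 l1 l2 c0 c1 c2 t) \<le> sup_norm (trinomial l0 l1 l2 c0 c1 c2)"
  unfolding sup_norm_def by (intro cSUP_upper bdd_aboveI2[OF cmod_trinomial_le]) simp

lemma trinomial_mult: "trinomial l0 l1 l2 (w * c0) (w * c1) (w * c2) t = w * trinomial l0 l1 l2 c0 c1 c2 t"
  by (simp add: trinomial_def algebra_simps)

lemma trinomial_swap01: "trinomial l1 l0 l2 c1 c0 c2 = trinomial l0 l1 l2 c0 c1 c2"
  and trinomial_swap12: "trinomial l0 l2 l1 c0 c2 c1 = trinomial l0 l1 l2 c0 c1 c2"
  by (simp_all add: trinomial_def fun_eq_iff add.commute add.left_commute)

lemma trinomial_eq_centred: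
  "trinomial m (m - d * p) (m + d * q) c0 c1 c2 t = cis (m * t) * centred p q c1 c0 c2 (d * t)"
proof -
  have "cis (of_int (m - d * p) * t) = cis (m * t) * cis (- (p * (d * t)))"
    "cis (of_int (m + d * q) * t) = cis (m * t) * cis (q * (d * t))"
    by (simp_all add: cis_mult algebra_simps)
  then show ?thesis by (simp add: trinomial_def centred_def algebra_simps)
qed

text \<open>The extremal problem, the Sidon constant and the unconditionality constants are all read
  off from this one property. It treats the three frequencies symmetrically, so it can be proved
  with the middle one first and then permuted. Uniqueness is up to factor and translation because
  both preserve equality.\<close>

definition sidon_sharp :: "int \<Rightarrow> int \<Rightarrow> int \<Rightarrow> complex \<Rightarrow> complex \<Rightarrow> complex \<Rightarrow> real \<Rightarrow> bool" where
  "sidon_sharp l0 l1 l2 a0 a1 a2 C \<longleftrightarrow>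
     0 < C \<and>
     (\<forall>c0 c1 c2. cmod c0 + cmod c1 + cmod c2 \<le> C * sup_norm (trinomial l0 l1 l2 c0 c1 c2)) \<and>
     cmod a0 + cmod a1 + cmod a2 = C * sup_norm (trinomial l0 l1 l2 a0 a1 a2) \<and>
     (\<forall>c0 c1 c2. cmod c0 + cmod c1 + cmod c2 = C * sup_norm (trinomial l0 l1 l2 c0 c1 c2) \<longrightarrow>
       (\<exists>w s. \<forall>t. trinomial l0 l1 l2 c0 c1 c2 t = w * trinomial l0 l1 l2 a0 a1 a2 (t + s)))"

lemma sidon_sharp_swap01:
  assumes "sidon_sharp l1 l0 l2 a1 a0 a2 C"
  shows "sidon_sharp l0 l1 l2 a0 a1 a2 C"
proof -
  have T: "trinomial l0 l1 l2 c0 c1 c2 = trinomial l1 l0 l2 c1 c0 c2" for c0 c1 c2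
    by (rule trinomial_swap01)
  have N: "cmod c0 + cmod c1 + cmod c2 = cmod c1 + cmod c0 + cmod c2" for c0 c1 c2
    by simp
  show ?thesis
    unfolding sidon_sharp_def
  proof (intro conjI allI impI)
    fix c0 c1 c2
    show "cmod c0 + cmod c1 + cmod c2 \<le> C * sup_norm (trinomial l0 l1 l2 c0 c1 c2)"
      unfolding T N[of c0 c1 c2] using assms by (simp add: sidon_sharp_def)
    assume "cmod c0 + cmod c1 + cmod c2 = C * sup_norm (trinomial l0 l1 l2 c0 c1 c2)"
    then show "\<exists>w s. \<forall>t. trinomial l0 l1 l2 c0 c1 c2 t = w * trinomial l0 l1 l2 a0 a1 a2 (t + s)"
      unfolding T N[of c0 c1 c2] using assms by (simp add: sidon_sharp_def)
  qed (use assms in \<open>simp_all add: sidon_sharp_def T N[of a0 a1 a2]\<close>)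
qed

lemma sidon_sharp_swap12:
  assumes "sidon_sharp l0 l2 l1 a0 a2 a1 C"
  shows "sidon_sharp l0 l1 l2 a0 a1 a2 C"
proof -
  have T: "trinomial l0 l1 l2 c0 c1 c2 = trinomial l0 l2 l1 c0 c2 c1" for c0 c1 c2
    by (rule trinomial_swap12)
  have N: "cmod c0 + cmod c1 + cmod c2 = cmod c0 + cmod c2 + cmod c1" for c0 c1 c2
    by simp
  show ?thesis
    unfolding sidon_sharp_def
  proof (intro conjI allI impI)
    fix c0 c1 c2
    show "cmod c0 + cmod c1 + cmod c2 \<le> C * sup_norm (trinomial l0 l1 l2 c0 c1 c2)"
      unfolding T N[of c0 c1 c2] using assms by (simp add: sidon_sharp_def)
    assume "cmod c0 + cmod c1 + cmod c2 = C * sup_norm (trinomial l0 l1 l2 c0 c1 c2)"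
    then show "\<exists>w s. \<forall>t. trinomial l0 l1 l2 c0 c1 c2 t = w * trinomial l0 l1 l2 a0 a1 a2 (t + s)"
      unfolding T N[of c0 c1 c2] using assms by (simp add: sidon_sharp_def)
  qed (use assms in \<open>simp_all add: sidon_sharp_def T N[of a0 a1 a2]\<close>)
qed

text \<open>With \<open>s = d * t\<close> the trinomial and its centred form differ by a unimodular
  factor, so the bound, its attainment and its equality case carry over. The coefficients have total
  modulus \<open>2 * d * (p + q)\<close>.\<close>

lemma sidon_sharp_centred:
  fixes m d p q :: int and e0 e1 e2 :: real
  assumes d: "0 < d" and pq: "0 < p" "0 < q" "coprime p q"
    and e: "e0 \<in> {-1, 1}" "e1 \<in> {-1, 1}" "e2 \<in> {-1, 1}"
    and sgn: "even q \<Longrightarrow> e0 * e2 = -1" "even (p + q) \<Longrightarrow> e1 * e2 = -1" "even p \<Longrightarrow> e1 * e0 = -1"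
  shows "sidon_sharp m (m - d * p) (m + d * q) (of_real (e0 * of_int (d * (p + q))))
     (of_real (e1 * of_int (d * q))) (of_real (e2 * of_int (d * p))) (1 / cos (pi / (2 * (p + q))))"
    (is "sidon_sharp ?l0 ?l1 ?l2 ?a0 ?a1 ?a2 ?C")
proof -
  let ?T = "trinomial ?l0 ?l1 ?l2"
  define \<kappa> where "\<kappa> = cos (pi / (2 * (p + q)))"
  have \<kappa>: "\<kappa> > 0" using cos_half_pi_div_pos[of "p + q"] pq by (simp add: \<kappa>_def)
  have T: "centred p q c1 c0 c2 s = cis (- (m * (s / d))) * ?T c0 c1 c2 (s / d)" for c0 c1 c2 s
    using d by (simp add: trinomial_eq_centred flip: mult.assoc) (simp add: cis_mult)
  have le: "cmod (centred p q c1 c0 c2 s) \<le> sup_norm (?T c0 c1 c2)" for c0 c1 c2 s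
    unfolding T norm_mult by (simp add: le_sup_norm_trinomial)
  have lower: "cmod c0 + cmod c1 + cmod c2 \<le> ?C * sup_norm (?T c0 c1 c2)" for c0 c1 c2
    using centred_lower_bound[OF pq, of c1 c0 c2, OF le[of c1 c0 c2]] \<kappa>
    unfolding \<kappa>_def[symmetric] by (simp add: field_simps)
  obtain s u where u: "cmod u = 1"
    and s: "\<And>h. centred p q (of_real (e1 * q)) (of_real (e0 * (p + q))) (of_real (e2 * p)) (s + h)
     = u * extremal_centred p q h"
    using centred_sign_extremal[OF pq e sgn] by blast
  have centred_a: "centred p q ?a1 ?a0 ?a2 h = of_int d * u * extremal_centred p q (h - s)" for h
  proof -
    have "centred p q ?a1 ?a0 ?a2 h
      = of_int d * centred p q (of_real (e1 * q)) (of_real (e0 * (p + q))) (of_real (e2 * p)) h"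
      by (simp add: centred_def algebra_simps)
    then show ?thesis using s[of "h - s"] by simp
  qed
  have norm_a: "cmod ?a0 + cmod ?a1 + cmod ?a2 = d * (2 * (p + q))"
  proof -
    have "cmod (of_real (e * of_int k)) = of_int k" if "e \<in> {-1, 1}" "0 < k" for e :: real and k :: int
      using that by (auto simp: norm_mult)
    moreover have "0 < d * (p + q)" "0 < d * q" "0 < d * p" using d pq by simp_all
    ultimately show ?thesis using e by (simp only:) (simp add: algebra_simps)
  qed
  \<comment> \<open>Only this direction needs computation; \<open>lower\<close> for the same
    coefficients is the reverse inequality.\<close>
  have "sup_norm (?T ?a0 ?a1 ?a2) \<le> d * (2 * (p + q) * \<kappa>)"
  proof (rule sup_norm_le)
    fix t :: real
    have "cmod (?T ?a0 ?a1 ?a2 t) = d * cmod (extremal_centred p q (d * t - s))"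
      unfolding trinomial_eq_centred centred_a using u d by (simp add: norm_mult)
    also have "\<dots> \<le> d * (2 * (p + q) * \<kappa>)"
      unfolding \<kappa>_def using extremal_centred_le[OF pq(1,2)] d by (intro mult_left_mono) auto
    finally show "cmod (?T ?a0 ?a1 ?a2 t) \<le> d * (2 * (p + q) * \<kappa>)" .
  qed
  then have "?C * sup_norm (?T ?a0 ?a1 ?a2) \<le> d * (2 * (p + q))"
    using \<kappa> unfolding \<kappa>_def[symmetric] by (simp add: field_simps)
  then have eq: "cmod ?a0 + cmod ?a1 + cmod ?a2 = ?C * sup_norm (?T ?a0 ?a1 ?a2)"
    using lower[of ?a0 ?a1 ?a2] norm_a by linarith
  have unique: "\<exists>w s. \<forall>t. ?T c0 c1 c2 t = w * ?T ?a0 ?a1 ?a2 (t + s)"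
    if c: "cmod c0 + cmod c1 + cmod c2 = ?C * sup_norm (?T c0 c1 c2)" for c0 c1 c2
  proof -
    have "cmod (centred p q c1 c0 c2 r) \<le> (cmod c1 + cmod c0 + cmod c2) * cos (pi / (2 * (p + q)))" for r
      using le[of c1 c0 c2 r] c \<kappa> unfolding \<kappa>_def[symmetric] by (simp add: field_simps)
    then obtain v r where r: "\<And>h. centred p q c1 c0 c2 (r + h) = v * extremal_centred p q h"
      using centred_equality[OF pq, of c1 c0 c2] by blast
    \<comment> \<open>The shift carrying the aligned point \<open>r\<close> of the given trinomial
      to the aligned point \<open>s\<close> of the extremal one, expressed in the variable t;
      \<open>z\<close> collects the factors picked up on the way.\<close>
    define \<sigma> where "\<sigma> = (s - r) / d"
    define z where "z = of_int d * u * cis (m * \<sigma>)"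
    have "z \<noteq> 0" using d u by (auto simp: z_def)
    have "?T c0 c1 c2 t = v / z * ?T ?a0 ?a1 ?a2 (t + \<sigma>)" for t
    proof -
      have "?T ?a0 ?a1 ?a2 (t + \<sigma>) = cis (m * t) * z * extremal_centred p q (d * (t + \<sigma>) - s)"
        unfolding trinomial_eq_centred centred_a z_def
        by (simp add: distrib_left cis_mult[symmetric] mult_ac)
      also have "d * (t + \<sigma>) - s = d * t - r"
        using d by (simp add: \<sigma>_def field_simps)
      finally show ?thesis
        using r[of "d * t - r"] \<open>z \<noteq> 0\<close> by (simp add: trinomial_eq_centred)
    qed
    then show ?thesis by blast
  qed
  show ?thesis
    unfolding sidon_sharp_def using lower eq unique \<kappa> by (auto simp: \<kappa>_def)
qed

section \<open>The sign rule and permutations of the frequencies\<close>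

text \<open>The reduced differences satisfy \<open>x1 = x0 + x2\<close> and have no common factor, so exactly
  one of them is even: in this form the conditions on the signs are symmetric in the three frequencies.\<close>

definition sign_rule :: "int \<Rightarrow> int \<Rightarrow> int \<Rightarrow> real \<Rightarrow> real \<Rightarrow> real \<Rightarrow> bool" where
  "sign_rule l0 l1 l2 e0 e1 e2 \<longleftrightarrow>
     e0 \<in> {-1, 1} \<and> e1 \<in> {-1, 1} \<and> e2 \<in> {-1, 1} \<and>
     (\<exists>d x0 x1 x2. 0 < d \<and> l1 - l2 = d * x0 \<and> l0 - l2 = d * x1 \<and> l0 - l1 = d * x2 \<and> coprime x1 x2 \<and>
       (even x0 \<longrightarrow> e1 * e2 = -1) \<and> (even x1 \<longrightarrow> e0 * e2 = -1) \<and> (even x2 \<longrightarrow> e0 * e1 = -1))"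

lemma sign_rule_swap12:
  assumes "sign_rule l0 l1 l2 e0 e1 e2"
  shows "sign_rule l0 l2 l1 e0 e2 e1"
proof -
  obtain d x0 x1 x2 where "0 < d" "l1 - l2 = d * x0" "l0 - l2 = d * x1" "l0 - l1 = d * x2" "coprime x1 x2"
    "even x0 \<longrightarrow> e1 * e2 = -1" "even x1 \<longrightarrow> e0 * e2 = -1" "even x2 \<longrightarrow> e0 * e1 = -1"
    using assms unfolding sign_rule_def by blast
  then have "0 < d \<and> l2 - l1 = d * (-x0) \<and> l0 - l1 = d * x2 \<and> l0 - l2 = d * x1 \<and> coprime x2 x1 \<and>
       (even (-x0) \<longrightarrow> e2 * e1 = -1) \<and> (even x2 \<longrightarrow> e0 * e1 = -1) \<and> (even x1 \<longrightarrow> e0 * e2 = -1)"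
    by (auto simp: mult.commute coprime_commute)
  then show ?thesis using assms unfolding sign_rule_def by blast
qed

lemma sign_rule_swap01:
  assumes "sign_rule l0 l1 l2 e0 e1 e2"
  shows "sign_rule l1 l0 l2 e1 e0 e2"
proof -
  obtain d x0 x1 x2 where x: "0 < d" "l1 - l2 = d * x0" "l0 - l2 = d * x1" "l0 - l1 = d * x2" "coprime x1 x2"
    "even x0 \<longrightarrow> e1 * e2 = -1" "even x1 \<longrightarrow> e0 * e2 = -1" "even x2 \<longrightarrow> e0 * e1 = -1"
    using assms unfolding sign_rule_def by blast
  \<comment> \<open>The exchange replaces the coprime pair \<open>x1\<close>, \<open>x2\<close> by
    \<open>x0\<close>, \<open>-x2\<close>; additivity of the differences shows that it has the same
    gcd.\<close>
  have "d * x1 = d * (x2 + x0)" using x(2-4) by (simp add: algebra_simps)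
  then have "x1 = x2 + x0" using x(1) by simp
  then have "coprime x0 (-x2)" using x(5) by (simp add: coprime_iff_gcd_eq_1 gcd.commute)
  then have "0 < d \<and> l0 - l2 = d * x1 \<and> l1 - l2 = d * x0 \<and> l1 - l0 = d * (-x2) \<and> coprime x0 (-x2) \<and>
       (even x1 \<longrightarrow> e0 * e2 = -1) \<and> (even x0 \<longrightarrow> e1 * e2 = -1) \<and> (even (-x2) \<longrightarrow> e1 * e0 = -1)"
    using x by (auto simp: mult.commute)
  then show ?thesis using assms unfolding sign_rule_def by blast
qed

abbreviation sharp_at :: "int \<Rightarrow> int \<Rightarrow> int \<Rightarrow> real \<Rightarrow> real \<Rightarrow> real \<Rightarrow> real \<Rightarrow> bool" where
  "sharp_at l0 l1 l2 e0 e1 e2 \<equiv> sidon_sharp l0 l1 l2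
     (of_real (e0 * of_int \<bar>l1 - l2\<bar>)) (of_real (e1 * of_int \<bar>l0 - l2\<bar>)) (of_real (e2 * of_int \<bar>l0 - l1\<bar>))"

lemma sharp_at_ordered:
  assumes "sign_rule l0 l1 l2 e0 e1 e2" and "l1 < l0" "l0 < l2"
  shows "\<exists>C. sharp_at l0 l1 l2 e0 e1 e2 C"
proof -
  obtain d x0 x1 x2 where x: "0 < d" "l1 - l2 = d * x0" "l0 - l2 = d * x1" "l0 - l1 = d * x2" "coprime x1 x2"
    "even x0 \<longrightarrow> e1 * e2 = -1" "even x1 \<longrightarrow> e0 * e2 = -1" "even x2 \<longrightarrow> e0 * e1 = -1"
    using assms unfolding sign_rule_def by blast
  have e: "e0 \<in> {-1, 1}" "e1 \<in> {-1, 1}" "e2 \<in> {-1, 1}" using assms unfolding sign_rule_def by blast+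
  \<comment> \<open>The reduced distances from the middle frequency down to \<open>l1\<close> and up
    to \<open>l2\<close>; both are positive.\<close>
  define p q where "p = x2" and "q = - x1"
  have "d * x0 = d * - (p + q)" using x(2-4) by (simp add: p_def q_def algebra_simps)
  then have x0: "x0 = - (p + q)" using x(1) by simp
  have "0 < d * p" "0 < d * q" using x assms by (simp_all add: p_def q_def)
  then have pq: "0 < p" "0 < q" "coprime p q"
    using x by (auto simp: p_def q_def zero_less_mult_iff mult_less_0_iff coprime_commute)
  have l: "l1 = l0 - d * p" "l2 = l0 + d * q" using x by (auto simp: p_def q_def)
  have "\<bar>l1 - l2\<bar> = d * (p + q)" "\<bar>l0 - l2\<bar> = d * q" "\<bar>l0 - l1\<bar> = d * p"
    using \<open>0 < d * p\<close> \<open>0 < d * q\<close> unfolding l by (simp_all add: algebra_simps)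
  then show ?thesis
    using sidon_sharp_centred[OF x(1) pq e, of l0] x(6-8) l
    unfolding x0 p_def q_def by (auto simp: mult.commute)
qed

lemma sharp_at_swap01: "\<exists>C. sharp_at l1 l0 l2 e1 e0 e2 C \<Longrightarrow> \<exists>C. sharp_at l0 l1 l2 e0 e1 e2 C"
  by (metis sidon_sharp_swap01 abs_minus_commute)

lemma sharp_at_swap12: "\<exists>C. sharp_at l0 l2 l1 e0 e2 e1 C \<Longrightarrow> \<exists>C. sharp_at l0 l1 l2 e0 e1 e2 C"
  by (metis sidon_sharp_swap12 abs_minus_commute)

lemma sharp_at_sign_rule:
  assumes s: "sign_rule l0 l1 l2 e0 e1 e2" and "l0 \<noteq> l1" "l0 \<noteq> l2" "l1 \<noteq> l2"
  shows "\<exists>C. sharp_at l0 l1 l2 e0 e1 e2 C"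
proof -
  have mid: "\<exists>C. sharp_at k0 k1 k2 f0 f1 f2 C"
    if "sign_rule k0 k1 k2 f0 f1 f2" "k1 < k0 \<and> k0 < k2 \<or> k2 < k0 \<and> k0 < k1" for k0 k1 k2 f0 f1 f2
    using that sharp_at_ordered sharp_at_swap12 sign_rule_swap12 by blast
  consider "l1 < l0 \<and> l0 < l2 \<or> l2 < l0 \<and> l0 < l1" | "l0 < l1 \<and> l1 < l2 \<or> l2 < l1 \<and> l1 < l0"
    | "l0 < l2 \<and> l2 < l1 \<or> l1 < l2 \<and> l2 < l0"
    using assms(2-) by linarith
  then show ?thesis
  proof cases
    case 1
    then show ?thesis using mid s by blast
  next
    case 2
    then show ?thesis using mid s sharp_at_swap01 sign_rule_swap01 by blast
  next
    case 3
    \<comment> \<open>Two adjacent transpositions bring the middle frequency from the third place to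
      the first, and two more undo this.\<close>
    then have "\<exists>C. sharp_at l2 l0 l1 e2 e0 e1 C"
      using mid s sign_rule_swap01 sign_rule_swap12 by blast
    then show ?thesis using sharp_at_swap01 sharp_at_swap12 by blast
  qed
qed

section \<open>The extremal problem and the Sidon constant\<close>

lemma sup_norm_pos_of_sharp:
  assumes "sidon_sharp l0 l1 l2 a0 a1 a2 C" "a0 \<noteq> 0"
  shows "0 < sup_norm (trinomial l0 l1 l2 a0 a1 a2)"
proof -
  have "0 < cmod a0" using assms(2) by simp
  then have "0 < cmod a0 + cmod a1 + cmod a2" by (intro add_pos_nonneg) auto
  then have "0 < C * sup_norm (trinomial l0 l1 l2 a0 a1 a2)" "0 < C"
    using assms(1) by (auto simp: sidon_sharp_def)
  then show ?thesis by (simp add: zero_less_mult_iff)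
qed

lemma sup_norm_mult:
  "sup_norm (trinomial l0 l1 l2 (w * c0) (w * c1) (w * c2)) \<le> cmod w * sup_norm (trinomial l0 l1 l2 c0 c1 c2)"
  by (rule sup_norm_le) (simp add: trinomial_mult norm_mult mult_left_mono le_sup_norm_trinomial)

text \<open>Under the constraint the coefficient sum is at most \<open>C\<close>, and dividing the
  sharp trinomial by its sup norm attains \<open>C\<close>. An extremal trinomial therefore has sum
  at least \<open>C\<close>, which forces equality in the Sidon bound, so that uniqueness
  applies.\<close>

lemma sidon_sharp_extremal:
  assumes sharp: "sidon_sharp l0 l1 l2 a0 a1 a2 C" and a0: "a0 \<noteq> 0"
  shows "\<exists>w. is_extremal l0 l1 l2 (w * a0) (w * a1) (w * a2)"
    and "is_extremal l0 l1 l2 c0 c1 c2 \<Longrightarrow>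
      \<exists>w s. \<forall>t. trinomial l0 l1 l2 c0 c1 c2 t = w * trinomial l0 l1 l2 a0 a1 a2 (t + s)"
proof -
  let ?T = "trinomial l0 l1 l2"
  have C: "0 < C" and le: "\<And>c0 c1 c2. cmod c0 + cmod c1 + cmod c2 \<le> C * sup_norm (?T c0 c1 c2)"
    and eq: "cmod a0 + cmod a1 + cmod a2 = C * sup_norm (?T a0 a1 a2)"
    and unique: "\<And>c0 c1 c2. cmod c0 + cmod c1 + cmod c2 = C * sup_norm (?T c0 c1 c2) \<Longrightarrow>
       \<exists>w s. \<forall>t. ?T c0 c1 c2 t = w * ?T a0 a1 a2 (t + s)"
    using sharp unfolding sidon_sharp_def by auto
  have N: "0 < sup_norm (?T a0 a1 a2)" by (rule sup_norm_pos_of_sharp[OF assms])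
  have le1: "cmod c0 + cmod c1 + cmod c2 \<le> C" if "sup_norm (?T c0 c1 c2) \<le> 1" for c0 c1 c2
  proof -
    have "C * sup_norm (?T c0 c1 c2) \<le> C * 1" using that C by (intro mult_left_mono) auto
    then show ?thesis using le[of c0 c1 c2] by simp
  qed
  define w :: complex where "w = of_real (1 / sup_norm (?T a0 a1 a2))"
  have w: "cmod w * sup_norm (?T a0 a1 a2) = 1" unfolding w_def norm_of_real using N by simp
  have wC: "cmod (w * a0) + cmod (w * a1) + cmod (w * a2) = C"
  proof -
    have "cmod (w * a0) + cmod (w * a1) + cmod (w * a2) = cmod w * (cmod a0 + cmod a1 + cmod a2)"
      by (simp add: norm_mult algebra_simps)
    also have "\<dots> = C * (cmod w * sup_norm (?T a0 a1 a2))" unfolding eq by simp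
    finally show ?thesis using w by simp
  qed
  have ext: "is_extremal l0 l1 l2 (w * a0) (w * a1) (w * a2)"
    unfolding is_extremal_def wC using sup_norm_mult[of l0 l1 l2 w a0 a1 a2] w le1 by auto
  then show "\<exists>w. is_extremal l0 l1 l2 (w * a0) (w * a1) (w * a2)" by blast
  assume c: "is_extremal l0 l1 l2 c0 c1 c2"
  then have c1: "sup_norm (?T c0 c1 c2) \<le> 1" by (simp add: is_extremal_def)
  have "cmod (w * a0) + cmod (w * a1) + cmod (w * a2) \<le> cmod c0 + cmod c1 + cmod c2"
    using c ext unfolding is_extremal_def by blast
  then have "C \<le> cmod c0 + cmod c1 + cmod c2" by (simp only: wC)
  moreover have "C * sup_norm (?T c0 c1 c2) \<le> C * 1" using c1 C by (intro mult_left_mono) auto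
  ultimately have "cmod c0 + cmod c1 + cmod c2 = C * sup_norm (?T c0 c1 c2)"
    using le[of c0 c1 c2] by linarith
  then show "\<exists>w s. \<forall>t. ?T c0 c1 c2 t = w * ?T a0 a1 a2 (t + s)" by (rule unique)
qed

lemma sum_triple:
  assumes "l0 \<noteq> l1" "l0 \<noteq> l2" "l1 \<noteq> l2" "A \<subseteq> {l0, l1, l2}"
  shows "sum f A = (if l0 \<in> A then f l0 else 0) + (if l1 \<in> A then f l1 else 0) + (if l2 \<in> A then f l2 else 0)"
proof -
  have "A = {l0, l1, l2} \<inter> A" using assms by auto
  then have "sum f A = (\<Sum>l\<in>{l0, l1, l2}. if l \<in> A then f l else 0)"
    by (metis sum.inter_restrict finite.emptyI finite.insertI)
  then show ?thesis using assms by (simp add: add.assoc)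
qed

lemma trig_poly_eq_trinomial:
  assumes "l0 \<noteq> l1" "l0 \<noteq> l2" "l1 \<noteq> l2" "A \<subseteq> {l0, l1, l2}"
  shows "trig_poly A c = trinomial l0 l1 l2 (if l0 \<in> A then c l0 else 0) (if l1 \<in> A then c l1 else 0) (if l2 \<in> A then c l2 else 0)"
  by (rule ext) (simp add: trig_poly_def trinomial_def sum_triple[OF assms])

text \<open>Polynomials with fewer frequencies are trinomials with zero coefficients. Testing a
  competing constant on the sharp trinomial and cancelling its positive sup norm gives
  minimality.\<close>

lemma sidon_sharp_sidon_constant:
  assumes l: "l0 \<noteq> l1" "l0 \<noteq> l2" "l1 \<noteq> l2"
    and sharp: "sidon_sharp l0 l1 l2 a0 a1 a2 C" and a0: "a0 \<noteq> 0"
  shows "is_sidon_constant {l0, l1, l2} C"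
  unfolding is_sidon_constant_def is_smallest_def
proof (intro conjI allI impI)
  fix A and c :: "int \<Rightarrow> complex"
  assume "finite A \<and> A \<subseteq> {l0, l1, l2}"
  then have A: "A \<subseteq> {l0, l1, l2}" ..
  have "(\<Sum>l\<in>A. cmod (c l)) = cmod (if l0 \<in> A then c l0 else 0) + cmod (if l1 \<in> A then c l1 else 0)
      + cmod (if l2 \<in> A then c l2 else 0)"
    by (simp add: sum_triple[OF l A])
  also have "\<dots> \<le> C * sup_norm (trig_poly A c)"
    unfolding trig_poly_eq_trinomial[OF l A] using sharp by (simp only: sidon_sharp_def)
  finally show "(\<Sum>l\<in>A. cmod (c l)) \<le> C * sup_norm (trig_poly A c)" .
next
  fix C'
  assume C': "\<forall>A c. finite A \<and> A \<subseteq> {l0, l1, l2} \<longrightarrow> (\<Sum>l\<in>A. cmod (c l)) \<le> C' * sup_norm (trig_poly A c)"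
  define c where "c = (\<lambda>l. if l = l0 then a0 else if l = l1 then a1 else a2)"
  have "(\<Sum>l\<in>{l0, l1, l2}. cmod (c l)) \<le> C' * sup_norm (trig_poly {l0, l1, l2} c)"
    using C' by simp
  also have "(\<Sum>l\<in>{l0, l1, l2}. cmod (c l)) = cmod a0 + cmod a1 + cmod a2"
    using l by (simp add: c_def)
  also have "\<dots> = C * sup_norm (trinomial l0 l1 l2 a0 a1 a2)" using sharp by (simp add: sidon_sharp_def)
  also have "trig_poly {l0, l1, l2} c = trinomial l0 l1 l2 a0 a1 a2"
    using l by (simp add: trig_poly_eq_trinomial[OF l order_refl] c_def)
  finally show "C \<le> C'" using sup_norm_pos_of_sharp[OF sharp a0] by simp
qed

section \<open>Unconditionality constants\<close>

lemma circle_val_surj: "\<exists>t. z = Circle (cis t)"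
proof -
  have "circle_val z = cis (Arg (circle_val z))"
    using rcis_cmod_Arg[of "circle_val z"] by (simp add: rcis_def)
  then show ?thesis by (metis circle_val_inverse)
qed

text \<open>Every point of the circle is some \<open>cis t\<close>, so both norms are suprema of the
  same set of values.\<close>

lemma norm_sum_circle_char:
  assumes "finite J"
  shows "norm (\<Sum>n\<in>J. b n *\<^sub>C circle_char n) = sup_norm (trig_poly J b)"
proof (rule antisym)
  let ?f = "\<Sum>n\<in>J. b n *\<^sub>C circle_char n"
  have app: "apply_bcontfun ?f (Circle (cis t)) = trig_poly J b t" for t
    using assms
    by (induction J) (simp_all add: trig_poly_def Circle_inverse cis_power_int scaleC_complex_def)
  have bd: "cmod (trig_poly J b t) \<le> norm ?f" for t
    unfolding app[symmetric] by (rule norm_bounded)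
  then show "sup_norm (trig_poly J b) \<le> norm ?f" by (rule sup_norm_le)
  \<comment> \<open>A real supremum is an upper bound only for a bounded family; \<open>bd\<close>
    supplies the bound.\<close>
  have le: "cmod (trig_poly J b t) \<le> sup_norm (trig_poly J b)" for t
    unfolding sup_norm_def using bd by (intro cSUP_upper bdd_aboveI2) auto
  show "norm ?f \<le> sup_norm (trig_poly J b)"
  proof (rule norm_bound)
    fix z
    show "norm (apply_bcontfun ?f z) \<le> sup_norm (trig_poly J b)"
      using circle_val_surj[of z] app le by metis
  qed
qed

text \<open>Unimodular signs preserve the coefficient sum, so \<open>C\<close> is admissible; the
  lower bound needs only real signs. Leaving \<open>\<Theta>\<close> free between these two extremes
  yields the same \<open>C\<close> for both unconditionality constants.\<close>

lemma sidon_sharp_uncond_constant: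
  assumes l: "l0 \<noteq> l1" "l0 \<noteq> l2" "l1 \<noteq> l2"
    and sharp: "sharp_at l0 l1 l2 e0 e1 e2 C"
    and e: "e0 \<in> {-1, 1}" "e1 \<in> {-1, 1}" "e2 \<in> {-1, 1}"
    and \<Theta>: "{-1, 1} \<subseteq> \<Theta>" "\<And>z. z \<in> \<Theta> \<Longrightarrow> cmod z = 1"
  shows "is_uncond_constant \<Theta> {l0, l1, l2} circle_char C"
proof -
  let ?T = "trinomial l0 l1 l2"
  define a0 a1 a2 :: complex where "a0 = of_real (e0 * of_int \<bar>l1 - l2\<bar>)"
    and "a1 = of_real (e1 * of_int \<bar>l0 - l2\<bar>)" and "a2 = of_real (e2 * of_int \<bar>l0 - l1\<bar>)"
  have S: "sidon_sharp l0 l1 l2 a0 a1 a2 C" using sharp by (simp only: a0_def a1_def a2_def)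
  have a: "a0 \<noteq> 0" "a1 \<noteq> 0" "a2 \<noteq> 0" using l e by (auto simp: a0_def a1_def a2_def)
  have norm: "norm (\<Sum>n\<in>{n \<in> {l0, l1, l2}. c n \<noteq> 0}. (\<theta> n * c n) *\<^sub>C circle_char n)
      = sup_norm (?T (\<theta> l0 * c l0) (\<theta> l1 * c l1) (\<theta> l2 * c l2))" for c \<theta> :: "int \<Rightarrow> complex"
  proof -
    let ?J = "{n \<in> {l0, l1, l2}. c n \<noteq> 0}"
    have J: "?J \<subseteq> {l0, l1, l2}" by auto
    then have fin: "finite ?J" by (rule finite_subset) simp
    \<comment> \<open>Off the support the coefficient is already 0, so summing over the support
      loses nothing.\<close>
    have "(if n \<in> ?J then \<theta> n * c n else 0) = \<theta> n * c n" if "n \<in> {l0, l1, l2}" for n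
      using that by auto
    then show ?thesis
      unfolding norm_sum_circle_char[OF fin] trig_poly_eq_trinomial[OF l J] by simp
  qed
  have norm1: "norm (\<Sum>n\<in>{n \<in> {l0, l1, l2}. c n \<noteq> 0}. c n *\<^sub>C circle_char n)
      = sup_norm (?T (c l0) (c l1) (c l2))" for c :: "int \<Rightarrow> complex"
    using norm[of "\<lambda>_. 1" c] by simp
  show ?thesis
    unfolding is_uncond_constant_def is_smallest_def norm norm1
  proof (intro conjI allI impI)
    fix \<theta> c :: "int \<Rightarrow> complex"
    assume "(\<forall>n\<in>{l0, l1, l2}. \<theta> n \<in> \<Theta>) \<and> finite {n \<in> {l0, l1, l2}. c n \<noteq> 0}"
    then have \<theta>: "cmod (\<theta> l0) = 1" "cmod (\<theta> l1) = 1" "cmod (\<theta> l2) = 1" using \<Theta> by auto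
    have "sup_norm (?T (\<theta> l0 * c l0) (\<theta> l1 * c l1) (\<theta> l2 * c l2)) \<le> cmod (c l0) + cmod (c l1) + cmod (c l2)"
      by (rule sup_norm_le, rule order_trans[OF cmod_trinomial_le]) (simp add: norm_mult \<theta>)
    also have "\<dots> \<le> C * sup_norm (?T (c l0) (c l1) (c l2))" using S by (simp add: sidon_sharp_def)
    finally show "sup_norm (?T (\<theta> l0 * c l0) (\<theta> l1 * c l1) (\<theta> l2 * c l2)) \<le> C * sup_norm (?T (c l0) (c l1) (c l2))" .
  next
    fix C'
    assume C': "\<forall>\<theta> c. (\<forall>n\<in>{l0, l1, l2}. \<theta> n \<in> \<Theta>) \<and> finite {n \<in> {l0, l1, l2}. c n \<noteq> 0} \<longrightarrow>
        sup_norm (?T (\<theta> l0 * c l0) (\<theta> l1 * c l1) (\<theta> l2 * c l2)) \<le> C' * sup_norm (?T (c l0) (c l1) (c l2))"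
    define c where "c = (\<lambda>l. if l = l0 then a0 else if l = l1 then a1 else a2)"
    \<comment> \<open>The signs of the sharp trinomial itself: multiplying by them replaces each
      coefficient by its modulus, and the value at t = 0 is then the whole coefficient sum.\<close>
    define \<theta> where "\<theta> = (\<lambda>l. of_real (if l = l0 then e0 else if l = l1 then e1 else e2) :: complex)"
    have c: "c l0 = a0" "c l1 = a1" "c l2 = a2" using l by (auto simp: c_def)
    have "\<theta> n \<in> \<Theta>" for n using e \<Theta>(1) by (auto simp: \<theta>_def)
    then have "sup_norm (?T (\<theta> l0 * a0) (\<theta> l1 * a1) (\<theta> l2 * a2)) \<le> C' * sup_norm (?T a0 a1 a2)"
      using C'[rule_format, of \<theta> c] unfolding c by simp
    moreover have "\<theta> l0 * a0 = of_real (cmod a0)" "\<theta> l1 * a1 = of_real (cmod a1)" "\<theta> l2 * a2 = of_real (cmod a2)"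
      using e l by (auto simp: \<theta>_def a0_def a1_def a2_def norm_mult)
    moreover have "cmod (?T (of_real (cmod a0)) (of_real (cmod a1)) (of_real (cmod a2)) 0) = cmod a0 + cmod a1 + cmod a2"
    proof -
      have "?T (of_real (cmod a0)) (of_real (cmod a1)) (of_real (cmod a2)) 0 = of_real (cmod a0 + cmod a1 + cmod a2)"
        by (simp add: trinomial_def)
      then show ?thesis by (simp only: norm_of_real) simp
    qed
    ultimately have "cmod a0 + cmod a1 + cmod a2 \<le> C' * sup_norm (?T a0 a1 a2)"
      using le_sup_norm_trinomial[of l0 l1 l2 "of_real (cmod a0)" "of_real (cmod a1)" "of_real (cmod a2)" 0] by simp
    then have "C * sup_norm (?T a0 a1 a2) \<le> C' * sup_norm (?T a0 a1 a2)" using S by (simp add: sidon_sharp_def)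
    then show "C \<le> C'" using sup_norm_pos_of_sharp[OF S a(1)] by simp
  qed
qed

section \<open>The sign conditions\<close>

text \<open>If \<open>a\<close> is odd, a power of 2 dividing \<open>d * a\<close> divides
  \<open>d\<close>, hence also \<open>d * b\<close>. If \<open>a\<close> is even, then
  \<open>b\<close> is odd, and the first power of 2 not dividing \<open>d\<close> separates the two
  products.\<close>

lemma power2_dvd_iff_even:
  fixes d a b :: int
  assumes d: "d \<noteq> 0" and "coprime a b"
  shows "(\<exists>j::nat. 2 ^ j dvd d * a \<and> \<not> 2 ^ j dvd d * b) \<longleftrightarrow> even a"
proof
  assume "\<exists>j::nat. 2 ^ j dvd d * a \<and> \<not> 2 ^ j dvd d * b"
  then obtain j :: nat where j: "2 ^ j dvd d * a" "\<not> 2 ^ j dvd d * b" by blast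
  show "even a"
  proof (rule ccontr)
    assume "odd a"
    then have "coprime (2 ^ j) a" by simp
    then have "2 ^ j dvd d" using j(1) by (simp add: coprime_dvd_mult_left_iff)
    then show False using j(2) by simp
  qed
next
  assume a: "even a"
  then have b: "odd b" using coprime_common_divisor[OF assms(2), of 2] by auto
  obtain d' where d': "d = 2 ^ multiplicity 2 d * d'" "\<not> 2 dvd d'"
    using multiplicity_decompose'[of d 2] d by auto
  let ?v = "multiplicity 2 d"
  have "2 ^ Suc ?v dvd d * a"
    by (subst d'(1)) (use a in \<open>auto simp: mult.assoc intro!: mult_dvd_mono\<close>)
  moreover have "\<not> 2 ^ Suc ?v dvd d * b"
  proof
    assume "2 ^ Suc ?v dvd d * b"
    then have "2 ^ ?v * 2 dvd 2 ^ ?v * (d' * b)" by (subst (asm) d'(1)) (simp add: mult_ac)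
    then have "2 dvd d' * b" by (subst (asm) dvd_mult_cancel_left) simp
    then show False using b d'(2) by simp
  qed
  ultimately show "\<exists>j::nat. 2 ^ j dvd d * a \<and> \<not> 2 ^ j dvd d * b" by blast
qed

lemma differences_gcd_decompose:
  fixes l0 l1 l2 :: int
  assumes "l0 \<noteq> l1"
  obtains d a b where "0 < d" "l1 - l0 = d * a" "l2 - l0 = d * b" "coprime a b"
proof -
  define d where "d = gcd (l1 - l0) (l2 - l0)"
  have "l1 - l0 \<noteq> 0" using assms by simp
  then have "0 < d" by (simp add: d_def)
  moreover have "l1 - l0 = d * ((l1 - l0) div d)" "l2 - l0 = d * ((l2 - l0) div d)"
    by (simp_all add: d_def)
  moreover have "coprime ((l1 - l0) div d) ((l2 - l0) div d)"
    unfolding d_def using \<open>l1 - l0 \<noteq> 0\<close> by (intro div_gcd_coprime) simp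
  ultimately show ?thesis by (rule that)
qed

text \<open>Exactly one of a, b and a - b is even, so the case where a and b are both odd is that of
  an even reduced difference \<open>a - b\<close> between \<open>l1\<close> and
  \<open>l2\<close>.\<close>

lemma sign_ruleI:
  assumes e: "e0 \<in> {-1, 1}" "e1 \<in> {-1, 1}" "e2 \<in> {-1, 1}"
    and d: "0 < d" "l1 - l0 = d * a" "l2 - l0 = d * b" "coprime a b"
    and "even a \<Longrightarrow> e0 * e1 = -1" "even b \<Longrightarrow> e0 * e2 = -1" "odd a \<Longrightarrow> odd b \<Longrightarrow> e1 * e2 = -1"
  shows "sign_rule l0 l1 l2 e0 e1 e2"
proof -
  have "\<not> (even a \<and> even b)" using coprime_common_divisor[OF d(4), of 2] by auto
  then have "0 < d \<and> l1 - l2 = d * (a - b) \<and> l0 - l2 = d * (- b) \<and> l0 - l1 = d * (- a) \<and> coprime (- b) (- a) \<and>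
       (even (a - b) \<longrightarrow> e1 * e2 = -1) \<and> (even (- b) \<longrightarrow> e0 * e2 = -1) \<and> (even (- a) \<longrightarrow> e0 * e1 = -1)"
    using assms by (auto simp: algebra_simps coprime_commute)
  then show ?thesis using e unfolding sign_rule_def by blast
qed

theorem proposition4p4:
  fixes l0 l1 l2 :: int
  assumes "l0 \<noteq> l1" and "l0 \<noteq> l2" and "l1 \<noteq> l2"
  shows
    "(\<forall>e0\<in>{-1, 1 :: real}. \<forall>e1\<in>{-1, 1 :: real}. \<forall>e2\<in>{-1, 1 :: real}. \<forall>a0 a1 a2 :: complex.
        ((\<exists>j::nat. 2 ^ j dvd l1 - l0 \<and> \<not> 2 ^ j dvd l2 - l0) \<longrightarrow> e0 * e1 = -1) \<and>
        ((\<exists>j::nat. \<not> 2 ^ j dvd l1 - l0 \<and> 2 ^ j dvd l2 - l0) \<longrightarrow> e0 * e2 = -1) \<and>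
        (\<not> (\<exists>j::nat. 2 ^ j dvd l1 - l0 \<and> \<not> 2 ^ j dvd l2 - l0) \<and>
         \<not> (\<exists>j::nat. \<not> 2 ^ j dvd l1 - l0 \<and> 2 ^ j dvd l2 - l0) \<longrightarrow> e1 * e2 = -1) \<and>
        a0 = of_real (e0 * of_int \<bar>l1 - l2\<bar>) \<and>
        a1 = of_real (e1 * of_int \<bar>l0 - l2\<bar>) \<and>
        a2 = of_real (e2 * of_int \<bar>l0 - l1\<bar>) \<longrightarrow>
        (\<exists>w::complex. is_extremal l0 l1 l2 (w * a0) (w * a1) (w * a2)) \<and>
        (\<forall>c0 c1 c2. is_extremal l0 l1 l2 c0 c1 c2 \<longrightarrow>
           (\<exists>(w::complex) (s::real). \<forall>t.
              trinomial l0 l1 l2 c0 c1 c2 t = w * trinomial l0 l1 l2 a0 a1 a2 (t + s))) \<and>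
        (\<exists>C. is_sidon_constant {l0, l1, l2} C \<and>
           cmod a0 + cmod a1 + cmod a2 = C * sup_norm (trinomial l0 l1 l2 a0 a1 a2))) \<and>
     (\<exists>C. is_complex_uncond_constant {l0, l1, l2} circle_char C \<and>
          is_real_uncond_constant {l0, l1, l2} circle_char C)"
proof -
  obtain d a b where d: "0 < d" "l1 - l0 = d * a" "l2 - l0 = d * b" "coprime a b"
    using differences_gcd_decompose[OF assms(1)] by blast
  have even_a: "(\<exists>j::nat. 2 ^ j dvd l1 - l0 \<and> \<not> 2 ^ j dvd l2 - l0) \<longleftrightarrow> even a"
    unfolding d(2,3) using d by (intro power2_dvd_iff_even) auto
  have even_b: "(\<exists>j::nat. \<not> 2 ^ j dvd l1 - l0 \<and> 2 ^ j dvd l2 - l0) \<longleftrightarrow> even b"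
    unfolding d(2,3) using power2_dvd_iff_even[of d b a] d by (auto simp: coprime_commute)
  show ?thesis
    unfolding even_a even_b
  proof (intro conjI ballI allI impI)
    fix e0 e1 e2 :: real and a0 a1 a2 :: complex
    assume e: "e0 \<in> {-1, 1}" "e1 \<in> {-1, 1}" "e2 \<in> {-1, 1}"
      and H: "(even a \<longrightarrow> e0 * e1 = -1) \<and> (even b \<longrightarrow> e0 * e2 = -1) \<and> (odd a \<and> odd b \<longrightarrow> e1 * e2 = -1) \<and>
        a0 = of_real (e0 * of_int \<bar>l1 - l2\<bar>) \<and>
        a1 = of_real (e1 * of_int \<bar>l0 - l2\<bar>) \<and>
        a2 = of_real (e2 * of_int \<bar>l0 - l1\<bar>)"
    have "sign_rule l0 l1 l2 e0 e1 e2" using H by (intro sign_ruleI[OF e d]) auto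
    then obtain C where S: "sidon_sharp l0 l1 l2 a0 a1 a2 C"
      using sharp_at_sign_rule[OF _ assms] H by blast
    have a0: "a0 \<noteq> 0" using H e assms by auto
    show "\<exists>w. is_extremal l0 l1 l2 (w * a0) (w * a1) (w * a2)" by (rule sidon_sharp_extremal(1)[OF S a0])
    show "\<exists>w s. \<forall>t. trinomial l0 l1 l2 c0 c1 c2 t = w * trinomial l0 l1 l2 a0 a1 a2 (t + s)"
      if "is_extremal l0 l1 l2 c0 c1 c2" for c0 c1 c2
      using that by (rule sidon_sharp_extremal(2)[OF S a0])
    show "\<exists>C. is_sidon_constant {l0, l1, l2} C \<and>
           cmod a0 + cmod a1 + cmod a2 = C * sup_norm (trinomial l0 l1 l2 a0 a1 a2)"
      using sidon_sharp_sidon_constant[OF assms S a0] S by (auto simp: sidon_sharp_def)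
  next
    \<comment> \<open>One admissible choice of signs is needed here, with \<open>e0 = 1\<close>. The
      other two are opposite, which settles the third condition; the negative one is
      \<open>e2\<close> if b is even and \<open>e1\<close> otherwise, which settles the first two
      since a and b are not both even.\<close>
    define e1 e2 :: real where "e1 = (if even b then 1 else -1)" and "e2 = (if even b then -1 else 1)"
    have e: "(1::real) \<in> {-1, 1}" "e1 \<in> {-1, 1}" "e2 \<in> {-1, 1}" by (auto simp: e1_def e2_def)
    have "\<not> (even a \<and> even b)" using coprime_common_divisor[OF d(4), of 2] by auto
    then have "sign_rule l0 l1 l2 1 e1 e2" by (intro sign_ruleI[OF e d]) (auto simp: e1_def e2_def)
    then obtain C where S: "sharp_at l0 l1 l2 1 e1 e2 C" using sharp_at_sign_rule[OF _ assms] by blast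
    show "\<exists>C. is_complex_uncond_constant {l0, l1, l2} circle_char C \<and>
          is_real_uncond_constant {l0, l1, l2} circle_char C"
      by (intro exI[of _ C] conjI sidon_sharp_uncond_constant[OF assms S e]) auto
  qed
qed

end
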